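(* Let $N\ge 2$ be an integer and let $\boldsymbol\nu\in\overline{\mathbb{W}}_N=\{\mathbf{x}\in\mathbb{R}^N:x_1\le x_2\le\cdots\le x_N\}$. Then for every $t>0$ and $\mathbf{x}\in\mathbb{W}_N=\{\mathbf{x}\in\mathbb{R}^N:x_1<x_2<\cdots<x_N\}$, $$\lim_{a\to0}\mathcal{P}_N^{a\nu,a}(t,\mathbf{x})\,d\mathbf{x}=p_N(t^{-1},\mathbf{x}/t\,|\,\boldsymbol\nu)\,d(\mathbf{x}/t)=p_N^{\nu}(t,\mathbf{x}|\mathbf{0})\,d\mathbf{x},$$ that is, as densities with respect to $d\mathbf{x}$ (with $d(\mathbf{x}/t)=t^{-N}d\mathbf{x}$), $$\lim_{a\to0}\mathcal{P}_N^{a\nu,a}(t,\mathbf{x})=t^{-N}p_N(t^{-1},\mathbf{x}/t\,|\,\boldsymbol\nu)=p_N^{\nu}(t,\mathbf{x}|\mathbf{0}).$$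
   Context: Here $a>0$ and $i=\sqrt{-1}$. Class-one Whittaker function (Givental's formula): for $\boldsymbol\nu\in\mathbb{C}^N$, $\mathbf{x}\in\mathbb{R}^N$, $$\psi^{(N)}_{\boldsymbol\nu}(\mathbf{x})=\int_{\mathbb{T}_N(\mathbf{x})}\exp\bigl(\mathcal{F}^{(N)}_{\boldsymbol\nu}(\mathbf{T})\bigr)d\mathbf{T},$$ where $\mathbb{T}_N(\mathbf{x})$ is the space of real lower triangular arrays $\mathbf{T}=(T_{j,k})_{1\le k\le j\le N}$ with $T_{N,k}=x_k$ for $1\le k\le N$ (the integration is over the remaining entries) and $$\mathcal{F}^{(N)}_{\boldsymbol\nu}(\mathbf{T})=\sum_{j=1}^N\nu_j\Bigl(\sum_{k=1}^jT_{j,k}-\sum_{k=1}^{j-1}T_{j-1,k}\Bigr)-\sum_{j=1}^{N-1}\sum_{k=1}^j\bigl\{e^{-(T_{j,k}-T_{j+1,k})}+e^{-(T_{j+1,k+1}-T_{j,k})}\bigr\}.$$ Sklyanin density: for $\boldsymbol\mu\in\mathbb{R}^N$, $$s_N(\boldsymbol\mu)=\frac{1}{(2\pi)^NN!}\prod_{1\le j<\ell\le N}|\Gamma(i(\mu_\ell-\mu_j))|^{-2}=\frac{1}{(2\pi)^NN!}\prod_{1\le j<\ell\le N}\Bigl\{(\mu_\ell-\mu_j)\frac{\sinh\pi(\mu_\ell-\mu_j)}{\pi}\Bigr\}.$$ For $\boldsymbol\nu\in\mathbb{R}^N$, $t>0$, $\mathbf{x}\in\mathbb{R}^N$, the entrance-law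 density (coming from "$-\infty\boldsymbol\rho$") of the O'Connell process with drift vector $\boldsymbol\nu$ and parameter $a$ is $$\mathcal{P}_N^{\nu,a}(t,\mathbf{x})=e^{-t|\boldsymbol\nu|^2/2a^2}\,\psi^{(N)}_{\boldsymbol\nu}(\mathbf{x}/a)\int_{\mathbb{R}^N}e^{-t|\mathbf{k}|^2/2}\psi^{(N)}_{-ia\mathbf{k}}(\mathbf{x}/a)s_N(a\mathbf{k})\,d\mathbf{k}.$$ $\mathcal{P}_N^{a\nu,a}$ denotes this density with $\boldsymbol\nu$ replaced by $a\boldsymbol\nu$. Noncolliding Brownian motion: let $p(t,y|x)=e^{-(x-y)^2/(2t)}/\sqrt{2\pi t}$ for $t>0$, $h_N(\mathbf{x})=\prod_{1\le j<\ell\le N}(x_\ell-x_j)$, and $q_N(t,\mathbf{y}|\mathbf{x})=\det_{1\le j,k\le N}[p(t,y_j|x_k)]$ for $\mathbf{x},\mathbf{y}\in\mathbb{W}_N$. The transition density of noncolliding Brownian motion without drift is $$p_N(t,\mathbf{y}|\mathbf{x})=\frac{h_N(\mathbf{y})}{h_N(\mathbf{x})}q_N(t,\mathbf{y}|\mathbf{x}),$$ and that of noncolliding Brownian motion with drift vector $\boldsymbol\nu\in\overline{\mathbb{W}}_N$ is $$p_N^\nu(t,\mathbf{y}|\mathbf{x})=e^{-t|\boldsymbol\nu|^2/2}\,\frac{\det_{1\le j,k\le N}[e^{\nu_jy_k}]}{\det_{1\le j,k\le N}[e^{\nu_jx_k}]}\,q_N(t,\mathbf{y}|\mathbf{x}),\qquad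 \mathbf{x},\mathbf{y}\in\mathbb{W}_N.$$ When the starting point lies in $\overline{\mathbb{W}}_N\setminus\mathbb{W}_N$ (in particular $\mathbf{0}$), or when some components of $\boldsymbol\nu$ coincide, these expressions are understood as the continuous extensions (limits from $\mathbb{W}_N$ in the starting point, respectively in $\boldsymbol\nu$). *)

theory Defs
  imports "HOL-Analysis.Analysis" "Jordan_Normal_Form.Determinant"
begin

text \<open>Vectors indexed by \<open>1, \<dots>, N\<close> are functions on \<open>nat\<close> of which only the values on
  \<open>{1..N}\<close> are used; the sets below impose no condition on the other values.  Since the topology
  on \<open>nat \<Rightarrow> real\<close> is the product topology, limits within these sets of functions depending on
  the coordinates \<open>1, \<dots>, N\<close> only are the limits in \<open>N\<close>-dimensional Euclidean space.\<close>

definition weyl_chamber :: "nat \<Rightarrow> (nat \<Rightarrow> real) set" where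
  "weyl_chamber N = {x. strict_mono_on {1..N} x}"

definition closed_weyl_chamber :: "nat \<Rightarrow> (nat \<Rightarrow> real) set" where
  "closed_weyl_chamber N = {x. mono_on {1..N} x}"

definition norm_sq :: "nat \<Rightarrow> (nat \<Rightarrow> real) \<Rightarrow> real" where
  "norm_sq N x = (\<Sum>j=1..N. (x j)\<^sup>2)"

definition index_pairs :: "nat \<Rightarrow> (nat \<times> nat) set" where
  "index_pairs N = {(j, l). 1 \<le> j \<and> j < l \<and> l \<le> N}"

text \<open>The library indexes matrix rows and columns from \<open>0\<close>.\<close>

definition det_mat :: "nat \<Rightarrow> (nat \<Rightarrow> nat \<Rightarrow> real) \<Rightarrow> real" where
  "det_mat N A = Determinant.det (mat N N (\<lambda>(j, k). A (Suc j) (Suc k)))"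

definition givental_exponent ::
    "nat \<Rightarrow> (nat \<Rightarrow> complex) \<Rightarrow> (nat \<times> nat \<Rightarrow> real) \<Rightarrow> complex" where
  "givental_exponent N \<nu> T =
     (\<Sum>j=1..N. \<nu> j * complex_of_real ((\<Sum>k=1..j. T (j, k)) - (\<Sum>k=1..j-1. T (j - 1, k))))
     - complex_of_real (\<Sum>j=1..N-1. \<Sum>k=1..j.
         exp (- (T (j, k) - T (j + 1, k))) + exp (- (T (j + 1, k + 1) - T (j, k))))"

text \<open>Triangular arrays with last row \<open>x\<close>: the free entries are those in the rows
  \<open>1, \<dots>, N - 1\<close>, and the integral is over these.\<close>

definition free_entries :: "nat \<Rightarrow> (nat \<times> nat) set" where
  "free_entries N = Sigma {1..<N} (\<lambda>j. {1..j})"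

definition with_last_row ::
    "nat \<Rightarrow> (nat \<Rightarrow> real) \<Rightarrow> (nat \<times> nat \<Rightarrow> real) \<Rightarrow> nat \<times> nat \<Rightarrow> real" where
  "with_last_row N x T = (\<lambda>(j, k). if j = N then x k else T (j, k))"

definition whittaker :: "nat \<Rightarrow> (nat \<Rightarrow> complex) \<Rightarrow> (nat \<Rightarrow> real) \<Rightarrow> complex" where
  "whittaker N \<nu> x =
     (\<integral>T. exp (givental_exponent N \<nu> (with_last_row N x T)) \<partial>(Pi\<^sub>M (free_entries N) (\<lambda>_. lborel)))"

text \<open>Where two coordinates of \<open>\<mu>\<close> coincide, \<open>Gamma 0 = 0\<close> and \<open>inverse 0 = 0\<close> make the
  product vanish, in agreement with the expression
  \<open>(\<mu> l - \<mu> j) * sinh (pi * (\<mu> l - \<mu> j)) / pi\<close> of its factors.\<close>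

definition sklyanin :: "nat \<Rightarrow> (nat \<Rightarrow> real) \<Rightarrow> real" where
  "sklyanin N \<mu> = 1 / ((2 * pi) ^ N * fact N) *
     (\<Prod>(j, l)\<in>index_pairs N. inverse ((cmod (Gamma (\<i> * complex_of_real (\<mu> l - \<mu> j))))\<^sup>2))"

text \<open>Complex-valued because the Whittaker functions are.\<close>

definition oconnell_density ::
    "nat \<Rightarrow> (nat \<Rightarrow> real) \<Rightarrow> real \<Rightarrow> real \<Rightarrow> (nat \<Rightarrow> real) \<Rightarrow> complex" where
  "oconnell_density N \<nu> a t x =
     complex_of_real (exp (- t * norm_sq N \<nu> / (2 * a\<^sup>2)))
     * whittaker N (\<lambda>j. complex_of_real (\<nu> j)) (\<lambda>j. x j / a)
     * (\<integral>k. complex_of_real (exp (- t * norm_sq N k / 2))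
            * whittaker N (\<lambda>j. - \<i> * complex_of_real (a * k j)) (\<lambda>j. x j / a)
            * complex_of_real (sklyanin N (\<lambda>j. a * k j))
          \<partial>(Pi\<^sub>M {1..N} (\<lambda>_. lborel)))"

definition heat_kernel :: "real \<Rightarrow> real \<Rightarrow> real \<Rightarrow> real" where
  "heat_kernel t y x = exp (- (x - y)\<^sup>2 / (2 * t)) / sqrt (2 * pi * t)"

definition vandermonde :: "nat \<Rightarrow> (nat \<Rightarrow> real) \<Rightarrow> real" where
  "vandermonde N x = (\<Prod>(j, l)\<in>index_pairs N. x l - x j)"

definition karlin_mcgregor :: "nat \<Rightarrow> real \<Rightarrow> (nat \<Rightarrow> real) \<Rightarrow> (nat \<Rightarrow> real) \<Rightarrow> real" where
  "karlin_mcgregor N t y x = det_mat N (\<lambda>j k. heat_kernel t (y j) (x k))"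

text \<open>The extension by limits from within \<open>S\<close> of a function continuous on \<open>S\<close>.\<close>

definition continuous_extension ::
    "'a::topological_space set \<Rightarrow> ('a \<Rightarrow> real) \<Rightarrow> 'a \<Rightarrow> real" where
  "continuous_extension S f z = (if z \<in> S then f z else Lim (at z within S) f)"

text \<open>In both densities the arguments are the time, the end point \<open>y\<close> and the starting point
  \<open>x\<close>.  The second one is extended jointly in drift and starting point, both of which may lie
  on the boundary of the chamber.\<close>

definition noncolliding_density ::
    "nat \<Rightarrow> real \<Rightarrow> (nat \<Rightarrow> real) \<Rightarrow> (nat \<Rightarrow> real) \<Rightarrow> real" where
  "noncolliding_density N t y = continuous_extension (weyl_chamber N)
     (\<lambda>x. vandermonde N y / vandermonde N x * karlin_mcgregor N t y x)"

definition noncolliding_drift_density ::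
    "nat \<Rightarrow> (nat \<Rightarrow> real) \<Rightarrow> real \<Rightarrow> (nat \<Rightarrow> real) \<Rightarrow> (nat \<Rightarrow> real) \<Rightarrow> real" where
  "noncolliding_drift_density N \<nu> t y x =
     continuous_extension (weyl_chamber N \<times> weyl_chamber N)
       (\<lambda>(\<nu>, x). exp (- t * norm_sq N \<nu> / 2)
          * (det_mat N (\<lambda>j k. exp (\<nu> j * y k)) / det_mat N (\<lambda>j k. exp (\<nu> j * x k)))
          * karlin_mcgregor N t y x)
       (\<nu>, x)"

end

theory Submission
  imports Defs "HOL-Probability.Sinc_Integral" "HOL-Probability.Characteristic_Functions"
begin

text \<open>Rescaling the triangular array by \<open>a\<close> turns the factors \<open>exp (- exp (- u))\<close> of Givental's integrand
  into \<open>exp (- exp (- u / a))\<close>, which tend to the indicator of \<open>u > 0\<close>.  Hence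
  \<open>a ^ (N * (N - 1) / 2)\<close> times the Whittaker function tends to the integral \<open>G \<nu> x\<close> of an exponential
  over the Gelfand-Tsetlin patterns with top row \<open>x\<close>.  Integrating out one row at a time gives
  \<open>h \<nu> * G \<nu> x = det (exp (\<nu> j * x k))\<close>, where \<open>h\<close> is the Vandermonde product.  The Sklyanin density at
  \<open>a * k\<close> is asymptotic to a multiple of \<open>a ^ (N * (N - 1)) * (h k)\<^sup>2\<close>, so the powers of \<open>a\<close> cancel, and the
  remaining Gaussian integral of \<open>G (- \<i> * k) x * (h k)\<^sup>2\<close> is evaluated by Andreief's identity and the
  fact that Gaussian Fourier moments are polynomials times a Gaussian.  Both noncolliding densities
  are read off the determinant formula.  They extend to the boundary of the chamber because \<open>G\<close> is
  continuous in \<open>\<nu>\<close>, and because for a starting point \<open>z\<close> near \<open>0\<close> each \<open>G \<nu> z\<close> is close to the volume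
  of the patterns with top row \<open>z\<close>, so that the ratio of two of them tends to \<open>1\<close>.\<close>

section \<open>Determinants\<close>

text \<open>The limit passes under two nested integrals, over arrays and over spectral variables, so
  the estimates must be uniform in \<open>a\<close>. They are proved once for a class
  \<open>wall\<close> that contains the hard wall and every soft wall with \<open>a \<le> 1\<close>.
  The double exponential decay common to this class beats the exponential of any linear form in the
  entries of the array. The bound depends on the parameters only through their real parts, so on the
  imaginary axis it does not involve the spectral variable at all. What remains there is the growth
  of the Sklyanin density, which is at most exponential and is absorbed by the Gaussian. The
  determinant formula is never divided by a Vandermonde product. It therefore holds for coinciding
  parameters too, and in the spectral integral one of the two Vandermonde factors supplied by the
  Sklyanin density completes it to a determinant, while the other is itself a determinant of powers.
  This is the shape that Andreief's identity needs.\<close>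

definition idet :: "nat \<Rightarrow> (nat \<Rightarrow> nat \<Rightarrow> 'a::comm_ring_1) \<Rightarrow> 'a" where
  "idet N A = Determinant.det (mat N N (\<lambda>(j, k). A (Suc j) (Suc k)))"

lemma of_real_det_mat: "complex_of_real (det_mat N A) = idet N (\<lambda>j k. complex_of_real (A j k))"
proof -
  have hom: "comm_ring_hom complex_of_real"
    by unfold_locales auto
  have "map_mat complex_of_real (mat N N (\<lambda>(j, k). A (Suc j) (Suc k))) =
      mat N N (\<lambda>(j, k). complex_of_real (A (Suc j) (Suc k)))"
    by (rule eq_matI) auto
  then show ?thesis
    unfolding det_mat_def idet_def by (metis comm_ring_hom.hom_det[OF hom])
qed

lemma idet_cong:
  assumes "\<And>j k. j \<in> {1..N} \<Longrightarrow> k \<in> {1..N} \<Longrightarrow> A j k = B j k"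
  shows "idet N A = idet N B"
  unfolding idet_def by (rule arg_cong[where f = Determinant.det], rule eq_matI) (auto simp: assms)

lemma idet_transpose: "idet N (\<lambda>j k. A k j) = idet N A"
proof -
  have "transpose_mat (mat N N (\<lambda>(j, k). A (Suc j) (Suc k))) = mat N N (\<lambda>(j, k). A (Suc k) (Suc j))"
    by (rule eq_matI) auto
  then show ?thesis
    unfolding idet_def by (metis Determinant.det_transpose mat_carrier)
qed

lemma prod_shift_Suc: "(\<Prod>i=0..<N. f (Suc i)) = (\<Prod>j=1..N. f j)"
  by (metis One_nat_def atLeastLessThanSuc_atLeastAtMost prod.shift_bounds_Suc_ivl)

text \<open>Permutations act on the library's indices \<open>{0..<N}\<close>, whereas rows and
  columns here run over \<open>{1..N}\<close>; this explains the form \<open>Suc (p (j - 1))\<close>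
  throughout.\<close>

lemma idet_leibniz:
  "idet N A = (\<Sum>p | p permutes {0..<N}. signof p * (\<Prod>j=1..N. A j (Suc (p (j - 1)))))"
proof -
  have "(\<Prod>i=0..<N. mat N N (\<lambda>(j, k). A (Suc j) (Suc k)) $$ (i, p i)) = (\<Prod>j=1..N. A j (Suc (p (j - 1))))"
    if "p permutes {0..<N}" for p
  proof -
    have "(\<Prod>i=0..<N. mat N N (\<lambda>(j, k). A (Suc j) (Suc k)) $$ (i, p i)) = (\<Prod>i=0..<N. A (Suc i) (Suc (p i)))"
      using permutes_in_image[OF that] by (intro prod.cong) auto
    also have "\<dots> = (\<Prod>j=1..N. A j (Suc (p (j - 1))))"
      by (subst prod_shift_Suc[symmetric]) simp
    finally show ?thesis .
  qed
  then show ?thesis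
    unfolding idet_def by (subst det_def'[of _ N]) (auto intro!: sum.cong)
qed

lemma prod_permuted:
  assumes "p permutes {0..<N}"
  shows "(\<Prod>j=1..N. c (Suc (p (j - 1)))) = (\<Prod>j=1..N. c j)"
proof -
  have "(\<Prod>j=1..N. c (Suc (p (j - 1)))) = (\<Prod>i=0..<N. c (Suc (p i)))"
    by (subst prod_shift_Suc[symmetric]) simp
  also have "\<dots> = (\<Prod>i=0..<N. c (Suc i))"
    using prod.permute[OF assms, of "\<lambda>i. c (Suc i)"] by (simp add: o_def)
  finally show ?thesis by (simp add: prod_shift_Suc)
qed

text \<open>Every term of the Leibniz expansion uses each row and each column exactly once, hence
  contains each of the factors exactly once.\<close>

lemma idet_scale:
  "idet N (\<lambda>j k. r j * c k * A j k) = (\<Prod>j=1..N. r j) * (\<Prod>k=1..N. c k) * idet N A"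
  unfolding idet_leibniz sum_distrib_left
  by (intro sum.cong) (auto simp: prod.distrib prod_permuted algebra_simps simp del: One_nat_def)

lemma idet_permute_rows:
  assumes "p permutes {0..<N}"
  shows "idet N (\<lambda>j k. A (Suc (p (j - 1))) k) = signof p * idet N A"
proof -
  have "mat N N (\<lambda>(i, k). mat N N (\<lambda>(j, k). A (Suc j) (Suc k)) $$ (p i, k)) =
     mat N N (\<lambda>(j, k). A (Suc (p j)) (Suc k))"
    using permutes_in_image[OF assms] by (intro eq_matI) auto
  then show ?thesis
    unfolding idet_def using det_permute_rows[OF mat_carrier assms, of "\<lambda>(j, k). A (Suc j) (Suc k)"]
    by simp
qed

text \<open>Subtracting from each column its right neighbour clears the last row up to its last entry.\<close>

lemma idet_last_row_ones:
  fixes A :: "nat \<Rightarrow> nat \<Rightarrow> 'a::idom"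
  assumes ones: "\<And>k. k \<in> {1..Suc N} \<Longrightarrow> A (Suc N) k = 1"
  shows "idet (Suc N) A = idet N (\<lambda>j k. A j k - A j (Suc k))"
proof -
  let ?A = "mat (Suc N) (Suc N) (\<lambda>(j, k). A (Suc j) (Suc k))"
  let ?U = "mat (Suc N) (Suc N) (\<lambda>(j, k). if j = k then 1 else if j = Suc k then - 1 else 0 :: 'a)"
  let ?B1 = "mat N N (\<lambda>(j, k). A (Suc j) (Suc k) - A (Suc j) (Suc (Suc k)))"
  let ?B2 = "mat N 1 (\<lambda>(j, k). A (Suc j) (Suc N))"
  have detU: "Determinant.det ?U = 1"
    by (subst det_lower_triangular[of "Suc N"]) (auto simp: prod_list_diag_prod)
  have entry: "(?A * ?U) $$ (i, k) = (if k < N then A (Suc i) (Suc k) - A (Suc i) (Suc (Suc k))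
      else A (Suc i) (Suc k))" if "i < Suc N" "k < Suc N" for i k
  proof -
    have "(?A * ?U) $$ (i, k) =
      (\<Sum>r=0..<Suc N. A (Suc i) (Suc r) * (if r = k then 1 else if r = Suc k then - 1 else 0))"
      using that by (simp add: scalar_prod_def)
    also have "\<dots> = (\<Sum>r=0..<Suc N. (if r = k then A (Suc i) (Suc k) else 0) +
        (if r = Suc k then - A (Suc i) (Suc (Suc k)) else 0))"
      by (intro sum.cong) auto
    also have "\<dots> = A (Suc i) (Suc k) + (if Suc k < Suc N then - A (Suc i) (Suc (Suc k)) else 0)"
      unfolding sum.distrib using that by (subst (1 2) sum.delta) auto
    finally show ?thesis by auto
  qed
  have "?A * ?U = four_block_mat ?B1 ?B2 (0\<^sub>m 1 N) (1\<^sub>m 1)"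
  proof (rule eq_matI)
    fix i k assume "i < dim_row (four_block_mat ?B1 ?B2 (0\<^sub>m 1 N) (1\<^sub>m 1))"
      and "k < dim_col (four_block_mat ?B1 ?B2 (0\<^sub>m 1 N) (1\<^sub>m 1))"
    then have ik: "i < Suc N" "k < Suc N" by auto
    consider "i < N" | "i = N" using ik by linarith
    then show "(?A * ?U) $$ (i, k) = four_block_mat ?B1 ?B2 (0\<^sub>m 1 N) (1\<^sub>m 1) $$ (i, k)"
      unfolding entry[OF ik] using ik by cases (auto simp: ones not_less less_Suc_eq)
  qed auto
  then have "Determinant.det (?A * ?U) = Determinant.det ?B1 * Determinant.det (1\<^sub>m 1)"
    by (simp only:) (rule det_four_block_mat_lower_left_zero[of _ N _ 1], auto)
  then show ?thesis
    unfolding idet_def by (subst (asm) det_mult[of _ "Suc N"]) (auto simp: detU)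
qed

definition vdm :: "nat \<Rightarrow> (nat \<Rightarrow> 'a::comm_ring_1) \<Rightarrow> 'a" where
  "vdm N x = (\<Prod>(j, l)\<in>index_pairs N. x l - x j)"

text \<open>Grouping the pairs by their larger index makes products over them grow by one block when
  a coordinate is added, which suits induction on \<open>N\<close>.\<close>

lemma index_pairs_eq: "index_pairs N = (\<lambda>(l, j). (j, l)) ` Sigma {1..N} (\<lambda>l. {1..<l})"
  by (auto simp: index_pairs_def image_iff)

lemma prod_index_pairs: "(\<Prod>(j, l)\<in>index_pairs N. f j l) = (\<Prod>l=1..N. \<Prod>j=1..<l. f j l)"
proof -
  have "(\<Prod>(j, l)\<in>index_pairs N. f j l) = (\<Prod>(l, j)\<in>Sigma {1..N} (\<lambda>l. {1..<l}). f j l)"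
    unfolding index_pairs_eq by (subst prod.reindex) (auto simp: inj_on_def case_prod_beta)
  then show ?thesis by (simp add: prod.Sigma)
qed

lemma finite_index_pairs [simp]: "finite (index_pairs N)"
  by (simp add: index_pairs_eq)

lemma vdm_0 [simp]: "vdm 0 x = 1"
  by (simp add: vdm_def prod_index_pairs)

lemma vdm_Suc: "vdm (Suc N) x = vdm N x * (\<Prod>j=1..N. x (Suc N) - x j)"
  by (simp add: vdm_def prod_index_pairs atLeastLessThanSuc_atLeastAtMost)

text \<open>The matrix of values is the coefficient matrix times the matrix of powers, and the
  degree bound makes the coefficient matrix lower triangular. The power determinant is left
  unevaluated because its own evaluation relies on this factorization.\<close>

lemma idet_poly_aux:
  fixes x :: "nat \<Rightarrow> 'a::idom"
  assumes deg: "\<And>j. j \<in> {1..N} \<Longrightarrow> degree (p j) < j"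
  shows "idet N (\<lambda>j k. poly (p j) (x k)) =
    (\<Prod>j=1..N. coeff (p j) (j - 1)) * idet N (\<lambda>j k. x k ^ (j - 1))"
proof -
  let ?C = "mat N N (\<lambda>(i, r). coeff (p (Suc i)) r)"
  let ?V = "mat N N (\<lambda>(r, k). x (Suc k) ^ r)"
  have eq: "mat N N (\<lambda>(j, k). poly (p (Suc j)) (x (Suc k))) = ?C * ?V"
  proof (rule eq_matI)
    fix i k assume "i < dim_row (?C * ?V)" "k < dim_col (?C * ?V)"
    then have ik: "i < N" "k < N" by auto
    have "poly (p (Suc i)) (x (Suc k)) = (\<Sum>r\<le>degree (p (Suc i)). coeff (p (Suc i)) r * x (Suc k) ^ r)"
      by (rule poly_altdef)
    also have "\<dots> = (\<Sum>r\<in>{0..<N}. coeff (p (Suc i)) r * x (Suc k) ^ r)"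
      using deg[of "Suc i"] ik by (intro sum.mono_neutral_left) (auto simp: coeff_eq_0)
    finally show "mat N N (\<lambda>(j, k). poly (p (Suc j)) (x (Suc k))) $$ (i, k) = (?C * ?V) $$ (i, k)"
      using ik by (simp add: scalar_prod_def)
  qed auto
  have "Determinant.det ?C = prod_list (diag_mat ?C)"
    using deg by (intro det_lower_triangular[of N]) (auto intro!: coeff_eq_0 less_le_trans[OF deg])
  also have "\<dots> = (\<Prod>i=0..<N. coeff (p (Suc i)) (Suc i - 1))"
    by (subst prod_list_diag_prod) (auto intro!: prod.cong)
  also have "\<dots> = (\<Prod>j=1..N. coeff (p j) (j - 1))"
    by (rule prod_shift_Suc)
  finally show ?thesis
    unfolding idet_def eq by (subst det_mult[of _ N]) auto
qed

text \<open>Newton's polynomials make the matrix of values triangular.\<close>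

lemma idet_powers:
  fixes x :: "nat \<Rightarrow> 'a::idom"
  shows "idet N (\<lambda>j k. x k ^ (j - 1)) = vdm N x"
proof -
  let ?p = "\<lambda>j. \<Prod>r=1..<j. [:- x r, 1:]"
  have monic: "lead_coeff (?p j) = 1" for j
    by (simp add: lead_coeff_prod)
  have deg: "degree (?p j) = j - 1" for j
    by (subst degree_prod_eq_sum_degree) auto
  \<comment> \<open>The polynomials are monic, so passing from them to powers does not change the
    determinant; their zeros at \<open>x 1, ..., x (j - 1)\<close> allow the same determinant to be
    read off the diagonal.\<close>
  have "idet N (\<lambda>j k. poly (?p j) (x k)) =
      (\<Prod>j=1..N. coeff (?p j) (j - 1)) * idet N (\<lambda>j k. x k ^ (j - 1))"
    by (rule idet_poly_aux) (auto simp: deg simp del: One_nat_def)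
  moreover have "coeff (?p j) (j - 1) = 1" for j
    using monic[of j] deg[of j] by simp
  moreover have "idet N (\<lambda>j k. poly (?p j) (x k)) = vdm N x"
  proof -
    let ?P = "mat N N (\<lambda>(j, k). poly (?p (Suc j)) (x (Suc k)))"
    have "Determinant.det ?P = prod_list (diag_mat ?P)"
    proof (rule det_upper_triangular[of _ N])
      show "upper_triangular ?P"
      proof (rule upper_triangularI)
        fix i k assume "k < i" "i < dim_row ?P"
        then have "poly (\<Prod>r=1..<Suc i. [:- x r, 1:]) (x (Suc k)) = 0"
          unfolding poly_prod by (intro prod_zero bexI[of _ "Suc k"]) auto
        with \<open>k < i\<close> \<open>i < dim_row ?P\<close> show "?P $$ (i, k) = 0" by simp
      qed
    qed auto
    also have "\<dots> = (\<Prod>i=0..<N. \<Prod>r=1..<Suc i. x (Suc i) - x r)"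
      by (subst prod_list_diag_prod) (auto intro!: prod.cong simp: poly_prod algebra_simps)
    also have "\<dots> = (\<Prod>j=1..N. \<Prod>r=1..<j. x j - x r)"
      by (rule prod_shift_Suc)
    finally show ?thesis
      by (simp add: idet_def vdm_def prod_index_pairs)
  qed
  ultimately show ?thesis by simp
qed

lemma idet_poly:
  fixes x :: "nat \<Rightarrow> 'a::idom"
  assumes "\<And>j. j \<in> {1..N} \<Longrightarrow> degree (p j) < j"
  shows "idet N (\<lambda>j k. poly (p j) (x k)) = (\<Prod>j=1..N. coeff (p j) (j - 1)) * vdm N x"
  using idet_poly_aux[of N p x, OF assms] by (simp only: idet_powers)

section \<open>Integrals of determinants over product measures\<close>

interpretation lborel_product: product_sigma_finite "\<lambda>_::'i. lborel :: real measure"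
  by standard

text \<open>The injection \<open>\<iota>\<close> serves two index sets: it is \<open>Pair N\<close>
  when a row of a triangular array is integrated out, and \<open>id\<close> for the spectral
  variables.\<close>

lemma integral_lborel_PiM_prod:
  fixes f :: "nat \<Rightarrow> real \<Rightarrow> complex"
  assumes inj: "inj_on \<iota> {1..N}" and int: "\<And>k. k \<in> {1..N} \<Longrightarrow> integrable lborel (f k)"
  shows "integrable (Pi\<^sub>M (\<iota> ` {1..N}) (\<lambda>_. lborel)) (\<lambda>y. \<Prod>k=1..N. f k (y (\<iota> k)))" (is ?I)
    and "(\<integral>y. (\<Prod>k=1..N. f k (y (\<iota> k))) \<partial>Pi\<^sub>M (\<iota> ` {1..N}) (\<lambda>_. lborel)) = (\<Prod>k=1..N. \<integral>y. f k y \<partial>lborel)"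
proof -
  define g where "g i = f (the_inv_into {1..N} \<iota> i)" for i
  have g: "g (\<iota> k) = f k" if "k \<in> {1..N}" for k
    using that inj by (simp add: g_def the_inv_into_f_f)
  have eq: "(\<Prod>i\<in>\<iota> ` {1..N}. g i (y i)) = (\<Prod>k=1..N. f k (y (\<iota> k)))" for y
    by (subst prod.reindex[OF inj]) (auto simp: g intro!: prod.cong)
  have *: "integrable lborel (g i)" if "i \<in> \<iota> ` {1..N}" for i
    using that int g by auto
  have fin: "finite (\<iota> ` {1..N})" by simp
  from lborel_product.product_integrable_prod[of "\<iota> ` {1..N}" g, OF fin *]
  show ?I by (simp only: eq)
  from lborel_product.product_integral_prod[of "\<iota> ` {1..N}" g, OF fin *]
  have "(\<integral>y. (\<Prod>k=1..N. f k (y (\<iota> k))) \<partial>Pi\<^sub>M (\<iota> ` {1..N}) (\<lambda>_. lborel)) =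
    (\<Prod>i\<in>\<iota> ` {1..N}. integral\<^sup>L lborel (g i))" by (simp only: eq)
  also have "\<dots> = (\<Prod>k=1..N. integral\<^sup>L lborel (f k))"
    by (subst prod.reindex[OF inj]) (auto simp: g intro!: prod.cong)
  finally show "(\<integral>y. (\<Prod>k=1..N. f k (y (\<iota> k))) \<partial>Pi\<^sub>M (\<iota> ` {1..N}) (\<lambda>_. lborel)) =
    (\<Prod>k=1..N. \<integral>y. f k y \<partial>lborel)" .
qed

text \<open>Each column depends on a variable of its own, so every Leibniz term is a product of
  functions of separate variables.\<close>

lemma integral_idet:
  fixes f :: "nat \<Rightarrow> nat \<Rightarrow> real \<Rightarrow> complex"
  assumes inj: "inj_on \<iota> {1..N}"
    and int: "\<And>j k. j \<in> {1..N} \<Longrightarrow> k \<in> {1..N} \<Longrightarrow> integrable lborel (f j k)"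
  shows "(\<integral>y. idet N (\<lambda>j k. f j k (y (\<iota> k))) \<partial>Pi\<^sub>M (\<iota> ` {1..N}) (\<lambda>_. lborel)) =
    idet N (\<lambda>j k. \<integral>y. f j k y \<partial>lborel)"
proof -
  \<comment> \<open>After transposition the products in the Leibniz expansion run over columns, that
    is, over the integration variables.\<close>
  have T: "idet N (\<lambda>j k. B j k) = idet N (\<lambda>j k. B k j)" for B :: "nat \<Rightarrow> nat \<Rightarrow> complex"
    by (rule idet_transpose[symmetric])
  have *: "integrable lborel (f (Suc (p (k - 1))) k)" if "p permutes {0..<N}" "k \<in> {1..N}" for p k
    using permutes_in_image[OF that(1), of "k - 1"] that(2) by (intro int) auto
  show ?thesis
    apply (subst (1 2) T)
    apply (simp only: idet_leibniz)
    apply (subst Bochner_Integration.integral_sum)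
     apply (auto intro!: sum.cong integral_lborel_PiM_prod[OF inj] *
        simp: integral_lborel_PiM_prod(2)[OF inj *] simp del: One_nat_def)
    done
qed

text \<open>Both determinants are expanded and each pair of permutations \<open>p\<close>,
  \<open>q\<close> is integrated factor by factor. Summing over \<open>q\<close> rebuilds the
  determinant with its rows permuted by \<open>p\<close>; the resulting sign cancels the sign of
  \<open>p\<close>, and \<open>fact N\<close> equal terms remain.\<close>

lemma andreief_identity:
  fixes f g :: "nat \<Rightarrow> real \<Rightarrow> complex" and w :: "real \<Rightarrow> complex"
  assumes int: "\<And>j k. j \<in> {1..N} \<Longrightarrow> k \<in> {1..N} \<Longrightarrow> integrable lborel (\<lambda>y. w y * f j y * g k y)"
  shows "(\<integral>y. (\<Prod>j=1..N. w (y j)) * idet N (\<lambda>j k. f k (y j)) * idet N (\<lambda>j k. g k (y j))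
      \<partial>Pi\<^sub>M {1..N} (\<lambda>_. lborel)) =
    fact N * idet N (\<lambda>j k. \<integral>y. w y * f j y * g k y \<partial>lborel)"
proof -
  let ?A = "\<lambda>j k. \<integral>y. w y * f j y * g k y \<partial>lborel"
  let ?\<Pi> = "{p. p permutes {0..<N}}"
  let ?h = "\<lambda>p q k y. w y * f (Suc (p (k - 1))) y * g (Suc (q (k - 1))) y"
  have *: "integrable lborel (?h p q k)" if "p \<in> ?\<Pi>" "q \<in> ?\<Pi>" "k \<in> {1..N}" for p q k
    using permutes_in_image[of p "{0..<N}" "k - 1"] permutes_in_image[of q "{0..<N}" "k - 1"] that
    by (intro int) (auto simp: Suc_le_eq)
  have "(\<Prod>j=1..N. w (y j)) * idet N (\<lambda>j k. f k (y j)) * idet N (\<lambda>j k. g k (y j)) =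
    (\<Sum>p\<in>?\<Pi>. \<Sum>q\<in>?\<Pi>. signof p * signof q * (\<Prod>k=1..N. ?h p q k (y (id k))))" for y
    unfolding idet_leibniz sum_distrib_left sum_distrib_right
    by (subst sum.swap) (simp add: prod.distrib algebra_simps)
  moreover have I1: "integrable (Pi\<^sub>M (id ` {1..N}) (\<lambda>_. lborel))
      (\<lambda>y. signof p * signof q * (\<Prod>k=1..N. ?h p q k (y (id k))))" if "p \<in> ?\<Pi>" "q \<in> ?\<Pi>" for p q
    using * that by (intro integrable_mult_right integral_lborel_PiM_prod(1)) auto
  ultimately have "(\<integral>y. (\<Prod>j=1..N. w (y j)) * idet N (\<lambda>j k. f k (y j)) * idet N (\<lambda>j k. g k (y j))
      \<partial>Pi\<^sub>M {1..N} (\<lambda>_. lborel)) =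
    (\<integral>y. (\<Sum>p\<in>?\<Pi>. \<Sum>q\<in>?\<Pi>. signof p * signof q * (\<Prod>k=1..N. ?h p q k (y (id k))))
      \<partial>Pi\<^sub>M (id ` {1..N}) (\<lambda>_. lborel))"
    by simp
  also have "\<dots> = (\<Sum>p\<in>?\<Pi>. \<Sum>q\<in>?\<Pi>.
      \<integral>y. signof p * signof q * (\<Prod>k=1..N. ?h p q k (y (id k))) \<partial>Pi\<^sub>M (id ` {1..N}) (\<lambda>_. lborel))"
    by (subst Bochner_Integration.integral_sum, intro Bochner_Integration.integrable_sum I1, assumption+,
        intro sum.cong refl Bochner_Integration.integral_sum I1)
  also have "\<dots> = (\<Sum>p\<in>?\<Pi>. \<Sum>q\<in>?\<Pi>. signof p * signof q * (\<Prod>k=1..N. ?A (Suc (p (k - 1))) (Suc (q (k - 1)))))"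
    by (intro sum.cong refl, subst integral_mult_right_zero, subst integral_lborel_PiM_prod(2))
      (use * in auto)
  also have "\<dots> = (\<Sum>p\<in>?\<Pi>. signof p * idet N (\<lambda>j k. ?A (Suc (p (j - 1))) k))"
    unfolding idet_leibniz sum_distrib_left by (simp add: algebra_simps)
  also have "\<dots> = (\<Sum>p\<in>?\<Pi>. signof p * (signof p * idet N ?A))"
    by (intro sum.cong refl arg_cong2[where f = "(*)"] idet_permute_rows) auto
  also have "\<dots> = (\<Sum>p\<in>?\<Pi>. idet N ?A)"
    by (intro sum.cong) (auto simp: sign_def)
  also have "\<dots> = fact N * idet N ?A"
    using card_permutations[of "{0..<N}" N] by simp
  finally show ?thesis .
qed

section \<open>Weights on triangular arrays\<close>

lemma free_entries_Suc: "free_entries (Suc N) = free_entries N \<union> Pair N ` {1..N}"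
  by (auto simp: free_entries_def less_Suc_eq image_iff)

lemma free_entries_disjoint: "Pair N ` {1..N} \<inter> free_entries N = {}"
  by (auto simp: free_entries_def)

lemma finite_free_entries [simp]: "finite (free_entries N)"
  by (simp add: free_entries_def)

text \<open>The Jacobian of rescaling an array is a power with exponent the number of free entries;
  in this form it can cancel against the powers of \<open>a\<close> from the Sklyanin density, which
  are counted by pairs.\<close>

lemma card_free_entries: "card (free_entries N) = card (index_pairs N)"
proof -
  have "bij_betw (\<lambda>(j, k). (k, Suc j)) (free_entries N) (index_pairs N)"
    by (rule bij_betwI[where g = "\<lambda>(j, l). (l - 1, j)"])
      (auto simp: free_entries_def index_pairs_def)
  then show ?thesis by (rule bij_betw_same_card)
qed

text \<open>The part of Givental's exponent that is linear in the array. The differences of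
  consecutive row sums form the weight of a Gelfand-Tsetlin pattern.\<close>

definition gt_linear :: "nat \<Rightarrow> (nat \<Rightarrow> complex) \<Rightarrow> (nat \<times> nat \<Rightarrow> real) \<Rightarrow> complex" where
  "gt_linear N \<nu> T =
     (\<Sum>j=1..N. \<nu> j * complex_of_real ((\<Sum>k=1..j. T (j, k)) - (\<Sum>k=1..j-1. T (j - 1, k))))"

text \<open>One factor for each interlacing inequality \<open>T (j + 1, k) \<le> T (j, k)\<close>
  and \<open>T (j, k) \<le> T (j + 1, k + 1)\<close>. With the wall function as an argument, the
  same expression covers the smooth weights and the indicator-like limit.\<close>

definition gt_weight :: "nat \<Rightarrow> (real \<Rightarrow> real) \<Rightarrow> (nat \<times> nat \<Rightarrow> real) \<Rightarrow> real" where
  "gt_weight N w T =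
     (\<Prod>j=1..N-1. \<Prod>k=1..j. w (T (j, k) - T (j + 1, k)) * w (T (j + 1, k + 1) - T (j, k)))"

definition gt_integrand ::
    "nat \<Rightarrow> (real \<Rightarrow> real) \<Rightarrow> (nat \<Rightarrow> complex) \<Rightarrow> (nat \<Rightarrow> real) \<Rightarrow> (nat \<times> nat \<Rightarrow> real) \<Rightarrow> complex" where
  "gt_integrand N w \<nu> x T =
     exp (gt_linear N \<nu> (with_last_row N x T)) * of_real (gt_weight N w (with_last_row N x T))"

definition gt_integral ::
    "nat \<Rightarrow> (real \<Rightarrow> real) \<Rightarrow> (nat \<Rightarrow> complex) \<Rightarrow> (nat \<Rightarrow> real) \<Rightarrow> complex" where
  "gt_integral N w \<nu> x = (\<integral>T. gt_integrand N w \<nu> x T \<partial>Pi\<^sub>M (free_entries N) (\<lambda>_. lborel))"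

text \<open>The value of the hard wall at \<open>0\<close> is the limit of the soft ones, which makes the convergence
  of the weights hold everywhere.\<close>

definition soft_wall :: "real \<Rightarrow> real \<Rightarrow> real" where
  "soft_wall a u = exp (- exp (- u / a))"

definition hard_wall :: "real \<Rightarrow> real" where
  "hard_wall u = (if u < 0 then 0 else if u = 0 then exp (- 1) else 1)"

lemma soft_wall_tendsto: "((\<lambda>a. soft_wall a u) \<longlongrightarrow> hard_wall u) (at_right 0)"
proof -
  consider "u < 0" | "u = 0" | "u > 0" by linarith
  then show ?thesis
  proof cases
    case 1
    then show ?thesis unfolding soft_wall_def hard_wall_def by (simp) real_asymp
  next
    case 2
    then show ?thesis unfolding soft_wall_def hard_wall_def by simp
  next
    case 3
    then show ?thesis unfolding soft_wall_def hard_wall_def by (simp) real_asymp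
  qed
qed

text \<open>For \<open>u < 0\<close> the envelope keeps the decay of the soft wall with
  \<open>a = 1\<close>, which is the slowest one for \<open>a \<le> 1\<close>; the summand
  \<open>1\<close> in the exponent makes it at least \<open>1\<close> for \<open>u \<ge> 0\<close>,
  where the walls may be as large as \<open>1\<close>.\<close>

definition wall :: "(real \<Rightarrow> real) \<Rightarrow> bool" where
  "wall w \<longleftrightarrow> w \<in> borel_measurable borel \<and> (\<forall>u. 0 \<le> w u \<and> w u \<le> exp (1 - exp (- u)))"

lemma wall_soft:
  assumes "0 < a" "a \<le> 1"
  shows "wall (soft_wall a)"
  unfolding wall_def
proof (intro conjI allI)
  show "soft_wall a \<in> borel_measurable borel"
    unfolding soft_wall_def by measurable
  fix u
  show "soft_wall a u \<le> exp (1 - exp (- u))"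
  proof (cases "u \<ge> 0")
    case True
    have "exp (- u) \<le> 1" using True by simp
    moreover have "0 \<le> exp (- u / a)" by simp
    ultimately show ?thesis unfolding soft_wall_def by (simp only: exp_le_cancel_iff)
  next
    case False
    with assms have "- u \<le> - u / a"
      using mult_left_mono_neg[of a 1 u] by (simp add: pos_divide_le_eq mult.commute)
    then have "exp (- u) \<le> exp (- u / a)" by (simp only: exp_le_cancel_iff)
    then have "- exp (- u / a) \<le> 1 - exp (- u)" by linarith
    then show ?thesis unfolding soft_wall_def by (simp only: exp_le_cancel_iff)
  qed
qed (auto simp: soft_wall_def)

lemma wall_hard: "wall hard_wall"
  unfolding wall_def
proof (intro conjI allI)
  show "hard_wall \<in> borel_measurable borel"
    unfolding hard_wall_def by measurable
  fix u show "hard_wall u \<le> exp (1 - exp (- u))"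
    by (auto simp: hard_wall_def)
qed (auto simp: hard_wall_def)

lemma gt_integrand_soft:
  "gt_integrand N (soft_wall 1) \<nu> x T = exp (givental_exponent N \<nu> (with_last_row N x T))"
proof -
  have "gt_weight N (soft_wall 1) T = exp (- (\<Sum>j=1..N-1. \<Sum>k=1..j.
         exp (- (T (j, k) - T (j + 1, k))) + exp (- (T (j + 1, k + 1) - T (j, k)))))" for T
    unfolding gt_weight_def soft_wall_def by (simp add: exp_sum sum_negf[symmetric] exp_add[symmetric])
  then show ?thesis
    unfolding gt_integrand_def gt_linear_def givental_exponent_def
    by (simp only: diff_conv_add_uminus exp_add exp_of_real flip: of_real_minus)
qed

lemma measurable_with_last_row:
  assumes "1 \<le> k" "k \<le> j" "j \<le> N"
  shows "(\<lambda>T. with_last_row N x T (j, k)) \<in> borel_measurable (Pi\<^sub>M (free_entries N) (\<lambda>_. lborel))"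
proof (cases "j = N")
  case False
  then have "(j, k) \<in> free_entries N" using assms by (auto simp: free_entries_def)
  then have "(\<lambda>T. T (j, k)) \<in> measurable (Pi\<^sub>M (free_entries N) (\<lambda>_. lborel)) (lborel :: real measure)"
    by (rule measurable_component_singleton)
  with False show ?thesis by (simp add: with_last_row_def)
qed (simp add: with_last_row_def)

lemma measurable_gt_weight:
  assumes "wall w"
  shows "(\<lambda>T. gt_weight N w (with_last_row N x T)) \<in> borel_measurable (Pi\<^sub>M (free_entries N) (\<lambda>_. lborel))"
proof -
  have [measurable]: "w \<in> borel_measurable borel" using assms by (simp add: wall_def)
  show ?thesis
    unfolding gt_weight_def
  proof (intro borel_measurable_prod)
    fix j k assume "j \<in> {1..N-1}" "k \<in> {1..j}"
    then have [measurable]: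
      "(\<lambda>T. with_last_row N x T (j, k)) \<in> borel_measurable (Pi\<^sub>M (free_entries N) (\<lambda>_. lborel))"
      "(\<lambda>T. with_last_row N x T (j + 1, k)) \<in> borel_measurable (Pi\<^sub>M (free_entries N) (\<lambda>_. lborel))"
      "(\<lambda>T. with_last_row N x T (j + 1, k + 1)) \<in> borel_measurable (Pi\<^sub>M (free_entries N) (\<lambda>_. lborel))"
      by (intro measurable_with_last_row; auto)+
    show "(\<lambda>T. w (with_last_row N x T (j, k) - with_last_row N x T (j + 1, k)) *
        w (with_last_row N x T (j + 1, k + 1) - with_last_row N x T (j, k)))
        \<in> borel_measurable (Pi\<^sub>M (free_entries N) (\<lambda>_. lborel))"
      by measurable
  qed
qed

lemma measurable_gt_linear:
  assumes c: "\<And>j. j \<in> {1..N} \<Longrightarrow> (\<lambda>k. \<nu> k j) \<in> borel_measurable K"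
  shows "(\<lambda>(k, T). gt_linear N (\<nu> k) (with_last_row N x T)) \<in>
    borel_measurable (K \<Otimes>\<^sub>M Pi\<^sub>M (free_entries N) (\<lambda>_. lborel))"
  unfolding gt_linear_def case_prod_beta
proof (intro borel_measurable_sum)
  fix j assume j: "j \<in> {1..N}"
  have row: "(\<lambda>T. (\<Sum>k=1..i. with_last_row N x T (i, k))) \<in>
      borel_measurable (Pi\<^sub>M (free_entries N) (\<lambda>_. lborel))" if "i \<le> N" for i
    using that by (intro borel_measurable_sum measurable_with_last_row) auto
  have [measurable]: "(\<lambda>T. (\<Sum>k=1..j. with_last_row N x T (j, k)) - (\<Sum>k=1..j-1. with_last_row N x T (j - 1, k))) \<in>
      borel_measurable (Pi\<^sub>M (free_entries N) (\<lambda>_. lborel))"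
    using j by (intro borel_measurable_diff row) auto
  note c[OF j, measurable]
  show "(\<lambda>p. \<nu> (fst p) j * complex_of_real ((\<Sum>k=1..j. with_last_row N x (snd p) (j, k)) -
      (\<Sum>k=1..j-1. with_last_row N x (snd p) (j - 1, k)))) \<in>
      borel_measurable (K \<Otimes>\<^sub>M Pi\<^sub>M (free_entries N) (\<lambda>_. lborel))"
    by measurable
qed

text \<open>Measurability jointly in a parameter and the array is what makes
  \<open>gt_integral\<close> a measurable function of the spectral variable.\<close>

lemma measurable_gt_integrand_pair:
  assumes "wall w" "\<And>j. j \<in> {1..N} \<Longrightarrow> (\<lambda>k. \<nu> k j) \<in> borel_measurable K"
  shows "(\<lambda>(k, T). gt_integrand N w (\<nu> k) x T) \<in>
    borel_measurable (K \<Otimes>\<^sub>M Pi\<^sub>M (free_entries N) (\<lambda>_. lborel))"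
proof -
  note [measurable] = measurable_gt_linear[OF assms(2)] measurable_gt_weight[OF assms(1)]
  show ?thesis
    unfolding gt_integrand_def by measurable
qed

lemma measurable_gt_integrand:
  assumes "wall w"
  shows "gt_integrand N w \<nu> x \<in> borel_measurable (Pi\<^sub>M (free_entries N) (\<lambda>_. lborel))"
proof -
  let ?P = "Pi\<^sub>M (free_entries N) (\<lambda>_. lborel :: real measure)"
  \<comment> \<open>A one-point parameter space reduces the case of fixed \<open>\<nu>\<close> to
    the joint statement.\<close>
  have "(\<lambda>(k, T). gt_integrand N w \<nu> x T) \<in> borel_measurable (count_space {()} \<Otimes>\<^sub>M ?P)"
    by (rule measurable_gt_integrand_pair[OF assms]) auto
  moreover have "(\<lambda>T. ((), T)) \<in> measurable ?P (count_space {()} \<Otimes>\<^sub>M ?P)"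
    by measurable
  ultimately have "(\<lambda>T. (\<lambda>(k, T). gt_integrand N w \<nu> x T) ((), T)) \<in> borel_measurable ?P"
    by (rule measurable_compose[rotated])
  then show ?thesis by simp
qed

text \<open>With \<open>v = - u \<ge> 0\<close> one has
  \<open>exp v \<ge> v\<^sup>2 / 2 \<ge> c * v - c\<^sup>2 / 2\<close>, so the double exponential
  gives exponential decay at an arbitrary rate \<open>c\<close>, at the price of a constant.\<close>

lemma wall_bound:
  assumes "wall w" "c \<ge> 0"
  shows "w u \<le> exp (1 + c\<^sup>2 / 2) * exp (- c * max 0 (- u))"
proof -
  have "1 - exp (- u) \<le> 1 + c\<^sup>2 / 2 + (- c * max 0 (- u))"
  proof (cases "u \<ge> 0")
    case False
    have "(- u)\<^sup>2 / 2 \<le> exp (- u)"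
      using exp_lower_Taylor_quadratic[of "- u"] False by simp
    moreover have "0 \<le> (c - (- u))\<^sup>2" by simp
    moreover have "(c - (- u))\<^sup>2 = c\<^sup>2 + (- u)\<^sup>2 - 2 * (c * (- u))"
      by (simp add: power2_eq_square algebra_simps)
    moreover have "- c * max 0 (- u) = - (c * (- u))" using False by simp
    ultimately show ?thesis by linarith
  next
    case True
    then have "max 0 (- u) = 0" by simp
    then have "- c * max 0 (- u) = 0" by (simp only: mult_zero_right)
    moreover have "0 \<le> exp (- u)" "0 \<le> c\<^sup>2 / 2" by simp_all
    ultimately show ?thesis by linarith
  qed
  then have "exp (1 - exp (- u)) \<le> exp (1 + c\<^sup>2 / 2 + (- c * max 0 (- u)))"
    by (simp only: exp_le_cancel_iff)
  then have "exp (1 - exp (- u)) \<le> exp (1 + c\<^sup>2 / 2) * exp (- c * max 0 (- u))"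
    by (simp only: exp_add)
  with assms show ?thesis unfolding wall_def by (meson order_trans)
qed

text \<open>The two walls penalize \<open>s\<close> for lying below \<open>A\<close> or above
  \<open>B\<close>, and the distances involved add up to at least
  \<open>\<bar>s\<bar> - \<bar>A\<bar> - \<bar>B\<bar>\<close>. Thus decay in \<open>s\<close> is
  bought with growth in its two neighbours.\<close>

lemma wall_pair_bound:
  assumes "wall w" "c \<ge> 0"
  shows "w (s - A) * w (B - s) \<le> (exp (1 + c\<^sup>2 / 2))\<^sup>2 * exp (c * (\<bar>A\<bar> + \<bar>B\<bar> - \<bar>s\<bar>))"
proof -
  have "w (s - A) * w (B - s) \<le> (exp (1 + c\<^sup>2 / 2) * exp (- c * max 0 (- (s - A)))) *
      (exp (1 + c\<^sup>2 / 2) * exp (- c * max 0 (- (B - s))))"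
    using assms by (intro mult_mono wall_bound) (auto simp: wall_def)
  also have "\<dots> = (exp (1 + c\<^sup>2 / 2))\<^sup>2 * exp (- c * (max 0 (- (s - A)) + max 0 (- (B - s))))"
    by (simp add: power2_eq_square exp_add[symmetric] algebra_simps)
  also have "\<dots> \<le> (exp (1 + c\<^sup>2 / 2))\<^sup>2 * exp (c * (\<bar>A\<bar> + \<bar>B\<bar> - \<bar>s\<bar>))"
  proof -
    have "- (max 0 (- (s - A)) + max 0 (- (B - s))) \<le> \<bar>A\<bar> + \<bar>B\<bar> - \<bar>s\<bar>" by linarith
    from mult_left_mono[OF this assms(2)]
    have "- c * (max 0 (- (s - A)) + max 0 (- (B - s))) \<le> c * (\<bar>A\<bar> + \<bar>B\<bar> - \<bar>s\<bar>)"
      by (simp only: mult_minus_left mult_minus_right)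
    then show ?thesis by (intro mult_left_mono) auto
  qed
  finally show ?thesis .
qed

text \<open>Rates that grow threefold from row to row dominate the two neighbours which each entry has
  in the row above.\<close>

lemma gt_weight_bound:
  assumes "c \<ge> 0"
  shows "\<exists>C>0. \<forall>w T. wall w \<longrightarrow> gt_weight N w T \<le>
    C * exp (- c * (\<Sum>j=1..N-1. \<Sum>k=1..j. \<bar>T (j, k)\<bar>) + 2 * c * 3 ^ N * (\<Sum>k=1..N. \<bar>T (N, k)\<bar>))"
proof -
  let ?c = "\<lambda>j. c * 3 ^ j"
  let ?R = "\<lambda>(T :: nat \<times> nat \<Rightarrow> real) j. \<Sum>k=1..j. \<bar>T (j, k)\<bar>"
  define C where "C = (\<Prod>j=1..N-1. \<Prod>k=1..j. (exp (1 + (?c j)\<^sup>2 / 2))\<^sup>2)"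
  have "gt_weight N w T \<le> C * exp (- c * (\<Sum>j=1..N-1. ?R T j) + 2 * c * 3 ^ N * ?R T N)"
    if w: "wall w" for w and T :: "nat \<times> nat \<Rightarrow> real"
  proof -
    let ?f = "\<lambda>j k. w (T (j, k) - T (j + 1, k)) * w (T (j + 1, k + 1) - T (j, k))"
    let ?g = "\<lambda>j k. (exp (1 + (?c j)\<^sup>2 / 2))\<^sup>2 *
        exp (?c j * (\<bar>T (j + 1, k)\<bar> + \<bar>T (j + 1, k + 1)\<bar> - \<bar>T (j, k)\<bar>))"
    have fg: "0 \<le> ?f j k \<and> ?f j k \<le> ?g j k" for j k
      using wall_pair_bound[OF w, of "?c j"] assms w by (simp add: wall_def)
    have "0 \<le> (\<Prod>k=1..j. ?f j k) \<and> (\<Prod>k=1..j. ?f j k) \<le> (\<Prod>k=1..j. ?g j k)" for j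
      using fg by (intro conjI prod_nonneg prod_mono) blast+
    then have "(\<Prod>j=1..N-1. \<Prod>k=1..j. ?f j k) \<le> (\<Prod>j=1..N-1. \<Prod>k=1..j. ?g j k)"
      by (intro prod_mono) blast
    then have "gt_weight N w T \<le> (\<Prod>j=1..N-1. \<Prod>k=1..j. (exp (1 + (?c j)\<^sup>2 / 2))\<^sup>2 *
        exp (?c j * (\<bar>T (j + 1, k)\<bar> + \<bar>T (j + 1, k + 1)\<bar> - \<bar>T (j, k)\<bar>)))"
      unfolding gt_weight_def .
    also have "\<dots> = C * exp (\<Sum>j=1..N-1. \<Sum>k=1..j. ?c j * (\<bar>T (j + 1, k)\<bar> + \<bar>T (j + 1, k + 1)\<bar> - \<bar>T (j, k)\<bar>))"
      unfolding C_def by (simp add: prod.distrib exp_sum)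
    also have "\<dots> \<le> C * exp (- c * (\<Sum>j=1..N-1. ?R T j) + 2 * c * 3 ^ N * ?R T N)"
    proof -
      have row: "(\<Sum>k=1..j. ?c j * (\<bar>T (j + 1, k)\<bar> + \<bar>T (j + 1, k + 1)\<bar> - \<bar>T (j, k)\<bar>)) \<le>
          ?c j * (2 * ?R T (Suc j) - ?R T j)" for j
      proof -
        have "(\<Sum>k=1..j. \<bar>T (j + 1, k)\<bar>) \<le> ?R T (Suc j)"
          unfolding Suc_eq_plus1 by (rule sum_mono2) auto
        moreover have "(\<Sum>k=1..j. \<bar>T (j + 1, k + 1)\<bar>) \<le> ?R T (Suc j)"
        proof -
          have "(\<Sum>k=1..j. \<bar>T (j + 1, k + 1)\<bar>) = (\<Sum>k=Suc 1..Suc j. \<bar>T (j + 1, k)\<bar>)"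
            by (simp only: sum.shift_bounds_cl_Suc_ivl) simp
          also have "\<dots> \<le> ?R T (Suc j)"
            unfolding Suc_eq_plus1 by (rule sum_mono2) auto
          finally show ?thesis .
        qed
        ultimately have "(\<Sum>k=1..j. \<bar>T (j + 1, k)\<bar> + \<bar>T (j + 1, k + 1)\<bar> - \<bar>T (j, k)\<bar>) \<le>
            2 * ?R T (Suc j) - ?R T j"
          by (simp add: sum.distrib sum_subtractf)
        from mult_left_mono[OF this, of "?c j"] assms show ?thesis
          by (simp add: sum_distrib_left)
      qed
      \<comment> \<open>Row \<open>n + 1\<close> receives \<open>2 * c * 3 ^ n\<close> from the row
        below and pays \<open>c * 3 ^ Suc n\<close>; the balance \<open>- c * 3 ^ n\<close> is at
        most \<open>- c\<close>.\<close>
      have tele: "(\<Sum>j=1..n. ?c j * (2 * ?R T (Suc j) - ?R T j)) \<le>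
          - c * (\<Sum>j=1..n. ?R T j) + 2 * ?c n * ?R T (Suc n)" for n
      proof (induction n)
        case 0
        then show ?case using assms by simp
      next
        case (Suc n)
        have "c * ?R T (Suc n) \<le> ?c n * ?R T (Suc n)"
          using assms by (intro mult_right_mono) (auto intro!: sum_nonneg simp: mult_le_cancel_left1)
        with Suc show ?case by (simp add: algebra_simps)
      qed
      have "(\<Sum>j=1..N-1. \<Sum>k=1..j. ?c j * (\<bar>T (j + 1, k)\<bar> + \<bar>T (j + 1, k + 1)\<bar> - \<bar>T (j, k)\<bar>)) \<le>
          (\<Sum>j=1..N-1. ?c j * (2 * ?R T (Suc j) - ?R T j))"
        by (intro sum_mono row)
      also have "\<dots> \<le> - c * (\<Sum>j=1..N-1. ?R T j) + 2 * c * 3 ^ N * ?R T N"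
      proof (cases N)
        case 0
        then show ?thesis by simp
      next
        case (Suc n)
        have "2 * ?c n * ?R T (Suc n) \<le> 2 * c * 3 ^ Suc n * ?R T (Suc n)"
          using assms by (intro mult_right_mono sum_nonneg) (auto simp: mult_le_cancel_left1)
        with tele[of n] Suc show ?thesis by simp
      qed
      finally have "exp (\<Sum>j=1..N-1. \<Sum>k=1..j. ?c j * (\<bar>T (j + 1, k)\<bar> + \<bar>T (j + 1, k + 1)\<bar> - \<bar>T (j, k)\<bar>)) \<le>
          exp (- c * (\<Sum>j=1..N-1. ?R T j) + 2 * c * 3 ^ N * ?R T N)" by simp
      moreover have "0 \<le> C" unfolding C_def by (intro prod_nonneg) auto
      ultimately show ?thesis by (rule mult_left_mono)
    qed
    finally show ?thesis .
  qed
  moreover have "C > 0" unfolding C_def by (intro prod_pos ballI) auto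
  ultimately show ?thesis by (intro exI[of _ C] conjI allI impI) auto
qed

text \<open>A free row occurs in two consecutive differences of row sums, the last row in only one;
  hence the coefficients \<open>2 * L\<close> and \<open>L\<close>.\<close>

lemma Re_gt_linear_bound:
  assumes L: "\<And>j. j \<in> {1..N} \<Longrightarrow> \<bar>Re (\<nu> j)\<bar> \<le> L" "L \<ge> 0"
  shows "Re (gt_linear N \<nu> T) \<le>
    2 * L * (\<Sum>j=1..N-1. \<Sum>k=1..j. \<bar>T (j, k)\<bar>) + L * (\<Sum>k=1..N. \<bar>T (N, k)\<bar>)"
proof -
  let ?R = "\<lambda>j. \<Sum>k=1..j. \<bar>T (j, k)\<bar>"
  have step: "Re (\<nu> j) * ((\<Sum>k=1..j. T (j, k)) - (\<Sum>k=1..j-1. T (j - 1, k))) \<le> L * (?R j + ?R (j - 1))"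
    if "j \<in> {1..N}" for j
  proof -
    have "\<bar>(\<Sum>k=1..j. T (j, k)) - (\<Sum>k=1..j-1. T (j - 1, k))\<bar> \<le> ?R j + ?R (j - 1)"
      by (intro order_trans[OF abs_triangle_ineq4] add_mono sum_abs)
    then have "\<bar>Re (\<nu> j) * ((\<Sum>k=1..j. T (j, k)) - (\<Sum>k=1..j-1. T (j - 1, k)))\<bar> \<le> L * (?R j + ?R (j - 1))"
      unfolding abs_mult using L(1)[OF that] L(2) by (intro mult_mono) auto
    then show ?thesis by linarith
  qed
  have "Re (gt_linear N \<nu> T) \<le> (\<Sum>j=1..N. L * (?R j + ?R (j - 1)))"
    unfolding gt_linear_def Re_sum using step by (intro sum_mono) simp
  also have "\<dots> = 2 * L * (\<Sum>j=1..N-1. ?R j) + L * ?R N"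
  proof (cases N)
    case (Suc n)
    have "(\<Sum>j=1..m. L * (?R j + ?R (j - 1))) + L * ?R m = 2 * L * (\<Sum>j=1..m. ?R j)" for m
      by (induction m) (auto simp: algebra_simps)
    from this[of n] Suc show ?thesis by (simp add: algebra_simps)
  qed simp
  finally show ?thesis .
qed

lemma sum_free_entries: "(\<Sum>i\<in>free_entries N. f i) = (\<Sum>j=1..N-1. \<Sum>k=1..j. f (j, k))"
proof -
  have "{1..<N} = {1..N-1}" by auto
  then show ?thesis unfolding free_entries_def by (simp add: sum.Sigma)
qed

text \<open>The constant is chosen before the wall, the parameters and the array. One integrable
  function therefore dominates the integrands for all walls and all parameters in a strip around the
  imaginary axis.\<close>

lemma gt_integrand_bound:
  assumes "L \<ge> 0"
  shows "\<exists>C>0. \<forall>w \<nu> T. wall w \<longrightarrow> (\<forall>j\<in>{1..N}. \<bar>Re (\<nu> j)\<bar> \<le> L) \<longrightarrow>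
    cmod (gt_integrand N w \<nu> x T) \<le> C * exp (- (\<Sum>i\<in>free_entries N. \<bar>T i\<bar>))"
proof -
  \<comment> \<open>Of this rate, \<open>2 * L\<close> cancels the growth of the linear part and
    \<open>1\<close> is left for integrability.\<close>
  let ?c = "2 * L + 1"
  have "?c \<ge> 0" using assms by simp
  from gt_weight_bound[OF this, of N] obtain C where C: "C > 0" and "\<forall>w T. wall w \<longrightarrow> gt_weight N w T \<le>
    C * exp (- ?c * (\<Sum>j=1..N-1. \<Sum>k=1..j. \<bar>T (j, k)\<bar>) + 2 * ?c * 3 ^ N * (\<Sum>k=1..N. \<bar>T (N, k)\<bar>))"
    by (elim exE conjE)
  note C2 = this(2)[rule_format]
  define X where "X = (\<Sum>k=1..N. \<bar>x k\<bar>)"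
  have "cmod (gt_integrand N w \<nu> x T) \<le>
      (C * exp (L * X + 2 * ?c * 3 ^ N * X)) * exp (- (\<Sum>i\<in>free_entries N. \<bar>T i\<bar>))"
    if w: "wall w" and \<nu>: "\<And>j. j \<in> {1..N} \<Longrightarrow> \<bar>Re (\<nu> j)\<bar> \<le> L" for w \<nu> T
  proof -
    let ?T = "with_last_row N x T"
    define S where "S = (\<Sum>j=1..N-1. \<Sum>k=1..j. \<bar>T (j, k)\<bar>)"
    have S: "(\<Sum>j=1..N-1. \<Sum>k=1..j. \<bar>?T (j, k)\<bar>) = S"
      unfolding S_def by (intro sum.cong) (auto simp: with_last_row_def)
    have X: "(\<Sum>k=1..N. \<bar>?T (N, k)\<bar>) = X"
      by (simp add: X_def with_last_row_def)
    have "0 \<le> gt_weight N w ?T"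
      unfolding gt_weight_def using w by (intro prod_nonneg ballI mult_nonneg_nonneg) (auto simp: wall_def)
    then have "cmod (gt_integrand N w \<nu> x T) = exp (Re (gt_linear N \<nu> ?T)) * gt_weight N w ?T"
      by (simp add: gt_integrand_def norm_mult norm_exp_eq_Re)
    also have "\<dots> \<le> exp (2 * L * S + L * X) * (C * exp (- ?c * S + 2 * ?c * 3 ^ N * X))"
    proof (rule mult_mono)
      show "exp (Re (gt_linear N \<nu> ?T)) \<le> exp (2 * L * S + L * X)"
        using Re_gt_linear_bound[of N \<nu> L ?T, OF \<nu> assms] unfolding S X by (simp only: exp_le_cancel_iff)
      show "gt_weight N w ?T \<le> C * exp (- ?c * S + 2 * ?c * 3 ^ N * X)"
        using C2[OF w, of ?T] unfolding S X .
    qed (use \<open>0 \<le> gt_weight N w ?T\<close> in simp_all)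
    also have "\<dots> = C * exp ((2 * L * S + L * X) + (- ?c * S + 2 * ?c * 3 ^ N * X))"
      by (simp only: exp_add mult_ac)
    also have "(2 * L * S + L * X) + (- ?c * S + 2 * ?c * 3 ^ N * X) = (L * X + 2 * ?c * 3 ^ N * X) + - S"
      by (simp add: algebra_simps)
    also have "C * exp \<dots> = (C * exp (L * X + 2 * ?c * 3 ^ N * X)) * exp (- S)"
      by (simp only: exp_add mult_ac)
    finally show ?thesis by (simp add: S_def sum_free_entries)
  qed
  moreover have "C * exp (L * X + 2 * ?c * 3 ^ N * X) > 0" using C(1) by simp
  ultimately show ?thesis
    by (intro exI[of _ "C * exp (L * X + 2 * ?c * 3 ^ N * X)"] conjI allI impI) auto
qed

text \<open>Comparison with the Cauchy density, by
  \<open>exp \<bar>y\<bar> \<ge> (1 + y\<^sup>2) / 2\<close>.\<close>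

lemma integrable_exp_minus_abs: "integrable lborel (\<lambda>y::real. exp (- \<bar>y\<bar>))"
proof (rule Bochner_Integration.integrable_bound)
  have e: "einterval (-\<infinity>) \<infinity> = UNIV" by (auto simp: einterval_def)
  show "integrable lborel (\<lambda>y::real. 2 * inverse (1 + y\<^sup>2))"
    using integrable_inverse_1_plus_square unfolding set_integrable_def e
    by (intro integrable_mult_right) simp
  show "AE y::real in lborel. norm (exp (- \<bar>y\<bar>)) \<le> norm (2 * inverse (1 + y\<^sup>2))"
  proof (rule AE_I2)
    fix y :: real
    have "(1 + y\<^sup>2) / 2 \<le> exp \<bar>y\<bar>"
      using exp_lower_Taylor_quadratic[of "\<bar>y\<bar>"] by simp
    moreover have "0 < 1 + y\<^sup>2" by (simp add: add_pos_nonneg)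
    ultimately have "inverse (exp \<bar>y\<bar>) \<le> inverse ((1 + y\<^sup>2) / 2)"
      by (intro le_imp_inverse_le) auto
    also have "\<dots> = 2 * inverse (1 + y\<^sup>2)" by (simp only: divide_inverse inverse_mult_distrib inverse_inverse_eq mult.commute)
    finally show "norm (exp (- \<bar>y\<bar>)) \<le> norm (2 * inverse (1 + y\<^sup>2))"
      by (simp add: exp_minus)
  qed
  show "(\<lambda>y::real. exp (- \<bar>y\<bar>)) \<in> borel_measurable lborel" by measurable
qed

lemma integrable_exp_minus_sum:
  assumes "finite I"
  shows "integrable (Pi\<^sub>M I (\<lambda>_. lborel)) (\<lambda>T. C * exp (- (\<Sum>i\<in>I. \<bar>T i\<bar>)) :: real)"
proof -
  have "integrable (Pi\<^sub>M I (\<lambda>_. lborel)) (\<lambda>T. C * (\<Prod>i\<in>I. exp (- \<bar>T i\<bar>)) :: real)"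
    by (rule integrable_mult_right)
      (rule lborel_product.product_integrable_prod[where f = "\<lambda>_ y. exp (- \<bar>y\<bar>)", OF assms integrable_exp_minus_abs])
  moreover have "(\<Prod>i\<in>I. exp (- \<bar>T i\<bar>)) = exp (- (\<Sum>i\<in>I. \<bar>T i\<bar>))" for T :: "_ \<Rightarrow> real"
    using exp_sum[OF assms, of "\<lambda>i. - \<bar>T i\<bar>"] by (simp add: sum_negf)
  ultimately show ?thesis by (simp only:)
qed

lemma integrable_gt_integrand:
  assumes "wall w"
  shows "integrable (Pi\<^sub>M (free_entries N) (\<lambda>_. lborel)) (gt_integrand N w \<nu> x)"
proof -
  define L where "L = (\<Sum>j=1..N. \<bar>Re (\<nu> j)\<bar>)"
  have "L \<ge> 0" unfolding L_def by (intro sum_nonneg) auto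
  from gt_integrand_bound[OF this, of N x] obtain C where "C > 0" and
    "\<forall>w \<nu> T. wall w \<longrightarrow> (\<forall>j\<in>{1..N}. \<bar>Re (\<nu> j)\<bar> \<le> L) \<longrightarrow>
      cmod (gt_integrand N w \<nu> x T) \<le> C * exp (- (\<Sum>i\<in>free_entries N. \<bar>T i\<bar>))"
    by (elim exE conjE)
  note C = this(2)[rule_format]
  have "\<bar>Re (\<nu> j)\<bar> \<le> L" if "j \<in> {1..N}" for j
    unfolding L_def using that by (intro member_le_sum) auto
  then have "norm (gt_integrand N w \<nu> x T) \<le> norm (C * exp (- (\<Sum>i\<in>free_entries N. \<bar>T i\<bar>)))" for T
    using C[OF assms, of \<nu> T] \<open>C > 0\<close> by (simp add: abs_mult)
  then show ?thesis
    using assms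
    by (intro Bochner_Integration.integrable_bound[OF integrable_exp_minus_sum[of "free_entries N" C]]
        measurable_gt_integrand AE_I2) auto
qed

text \<open>Walls and parameters vary together, so that this one statement yields both the limit of
  soft walls at fixed parameters and the continuity in \<open>\<nu>\<close> for the hard
  wall.\<close>

lemma gt_integral_tendsto:
  assumes w: "\<And>n. wall (w n)" "wall w'" "\<And>u. (\<lambda>n. w n u) \<longlonglongrightarrow> w' u"
    and \<nu>: "\<And>j. j \<in> {1..N} \<Longrightarrow> (\<lambda>n. \<nu> n j) \<longlonglongrightarrow> \<nu>' j"
  shows "(\<lambda>n. gt_integral N (w n) (\<nu> n) x) \<longlonglongrightarrow> gt_integral N w' \<nu>' x"
proof -
  \<comment> \<open>Convergent parameter sequences are bounded, which places all their terms in a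
    common strip of width \<open>L\<close>.\<close>
  have "\<exists>B. \<forall>n. cmod (\<nu> n j) \<le> B" if "j \<in> {1..N}" for j
  proof -
    have "Bseq (\<lambda>n. \<nu> n j)"
      using \<nu>[OF that] by (intro convergent_imp_Bseq convergentI)
    then show ?thesis by (auto simp: Bseq_def)
  qed
  then have "\<forall>j\<in>{1..N}. \<exists>B. \<forall>n. cmod (\<nu> n j) \<le> B" by (rule ballI)
  then obtain B where "\<forall>j\<in>{1..N}. \<forall>n. cmod (\<nu> n j) \<le> B j"
    by (rule bchoice[THEN exE])
  note B = this[rule_format]
  define L where "L = (\<Sum>j=1..N. \<bar>B j\<bar>)"
  have "L \<ge> 0" unfolding L_def by (intro sum_nonneg) auto
  from gt_integrand_bound[OF this, of N x] obtain C where "C > 0" and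
    "\<forall>w \<nu> T. wall w \<longrightarrow> (\<forall>j\<in>{1..N}. \<bar>Re (\<nu> j)\<bar> \<le> L) \<longrightarrow>
      cmod (gt_integrand N w \<nu> x T) \<le> C * exp (- (\<Sum>i\<in>free_entries N. \<bar>T i\<bar>))"
    by (elim exE conjE)
  note C = this(2)[rule_format]
  have L: "\<bar>Re (\<nu> n j)\<bar> \<le> L" if "j \<in> {1..N}" for n j
  proof -
    have "\<bar>Re (\<nu> n j)\<bar> \<le> \<bar>B j\<bar>"
      using abs_Re_le_cmod[of "\<nu> n j"] B[OF that, of n] by linarith
    also have "\<dots> \<le> L" unfolding L_def using that by (intro member_le_sum) auto
    finally show ?thesis .
  qed
  show ?thesis
    unfolding gt_integral_def
  proof (rule integral_dominated_convergence[where w = "\<lambda>T. C * exp (- (\<Sum>i\<in>free_entries N. \<bar>T i\<bar>))"])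
    show "integrable (Pi\<^sub>M (free_entries N) (\<lambda>_. lborel)) (\<lambda>T. C * exp (- (\<Sum>i\<in>free_entries N. \<bar>T i\<bar>)) :: real)"
      by (rule integrable_exp_minus_sum) simp
    show "AE T in Pi\<^sub>M (free_entries N) (\<lambda>_. lborel). (\<lambda>n. gt_integrand N (w n) (\<nu> n) x T) \<longlonglongrightarrow> gt_integrand N w' \<nu>' x T"
    proof (rule AE_I2)
      fix T
      let ?T = "with_last_row N x T"
      have "(\<lambda>n. gt_linear N (\<nu> n) ?T) \<longlonglongrightarrow> gt_linear N \<nu>' ?T"
        unfolding gt_linear_def by (intro tendsto_sum tendsto_mult \<nu> tendsto_const)
      moreover have "(\<lambda>n. gt_weight N (w n) ?T) \<longlonglongrightarrow> gt_weight N w' ?T"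
        unfolding gt_weight_def by (intro tendsto_prod tendsto_mult w(3))
      ultimately show "(\<lambda>n. gt_integrand N (w n) (\<nu> n) x T) \<longlonglongrightarrow> gt_integrand N w' \<nu>' x T"
        unfolding gt_integrand_def by (intro tendsto_mult tendsto_exp tendsto_of_real)
    qed
    show "AE T in Pi\<^sub>M (free_entries N) (\<lambda>_. lborel). norm (gt_integrand N (w n) (\<nu> n) x T) \<le>
        C * exp (- (\<Sum>i\<in>free_entries N. \<bar>T i\<bar>))" for n
      by (rule AE_I2) (rule C[OF w(1) L])
  qed (rule measurable_gt_integrand, rule w)+
qed

section \<open>Rescaling, and the determinant formula\<close>

lemma gt_linear_cong:
  assumes "\<And>j k. 1 \<le> k \<Longrightarrow> k \<le> j \<Longrightarrow> j \<le> N \<Longrightarrow> T (j, k) = T' (j, k)"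
  shows "gt_linear N \<nu> T = gt_linear N \<nu> T'"
  unfolding gt_linear_def using assms by (intro sum.cong arg_cong2[where f = "(*)"] arg_cong[where f = complex_of_real]
      arg_cong2[where f = "(-)"] refl) auto

lemma gt_weight_cong:
  assumes "\<And>j k. 1 \<le> k \<Longrightarrow> k \<le> j \<Longrightarrow> j \<le> N \<Longrightarrow> T (j, k) = T' (j, k)"
  shows "gt_weight N w T = gt_weight N w T'"
  unfolding gt_weight_def using assms by (intro prod.cong arg_cong2[where f = "(*)"] arg_cong[where f = w]
      arg_cong2[where f = "(-)"] refl) auto

lemma gt_linear_Suc:
  "gt_linear (Suc N) \<nu> T = gt_linear N \<nu> T +
    \<nu> (Suc N) * complex_of_real ((\<Sum>k=1..Suc N. T (Suc N, k)) - (\<Sum>k=1..N. T (N, k)))"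
  by (simp add: gt_linear_def)

lemma gt_weight_Suc:
  "gt_weight (Suc N) w T = gt_weight N w T *
    (\<Prod>k=1..N. w (T (N, k) - T (Suc N, k)) * w (T (Suc N, Suc k) - T (N, k)))"
  by (cases N) (simp_all add: gt_weight_def)

lemma emeasure_lborel_scale:
  fixes c :: real
  assumes "c > 0" "A \<in> sets borel"
  shows "emeasure lborel A = ennreal c * emeasure lborel ((\<lambda>y. c * y) -` A)"
proof -
  have "emeasure lborel A = emeasure (density (distr lborel borel (\<lambda>y. 0 + c * y)) (\<lambda>_. ennreal \<bar>c\<bar>)) A"
    using lborel_real_affine[of c 0] assms by simp
  also have "\<dots> = ennreal c * emeasure lborel ((\<lambda>y. c * y) -` A)"
    using assms by (simp add: emeasure_density_const emeasure_distr)
  finally show ?thesis .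
qed

text \<open>It suffices to compare boxes, and the preimage of a box under the scaling is again a
  box. The map is restricted to \<open>I\<close> because points of the product space are
  extensional.\<close>

lemma PiM_lborel_scale:
  fixes c :: real
  assumes fin: "finite I" and c: "c > 0"
  shows "density (distr (Pi\<^sub>M I (\<lambda>_. lborel)) (Pi\<^sub>M I (\<lambda>_. lborel)) (\<lambda>T. \<lambda>i\<in>I. c * T i)) (\<lambda>_. ennreal (c ^ card I))
    = Pi\<^sub>M I (\<lambda>_. lborel :: real measure)" (is "?D = ?P")
proof (rule lborel_product.PiM_eqI[OF fin])
  have meas: "(\<lambda>T. \<lambda>i\<in>I. c * T i) \<in> measurable ?P ?P"
    by (intro measurable_restrict) measurable
  fix A :: "'a \<Rightarrow> real set" assume A: "\<And>i. i \<in> I \<Longrightarrow> A i \<in> sets lborel"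
  have AE: "Pi\<^sub>E I A \<in> sets ?P" using fin A by (intro sets_PiM_I_finite)
  have vim: "(\<lambda>T. \<lambda>i\<in>I. c * T i) -` Pi\<^sub>E I A \<inter> space ?P = Pi\<^sub>E I (\<lambda>i. (\<lambda>y. c * y) -` A i)"
    by (auto simp: space_PiM PiE_iff extensional_def)
  have "(\<lambda>y. c * y) -` A i \<in> sets lborel" if "i \<in> I" for i
    using A[OF that] measurable_sets[of "\<lambda>y. c * y" borel borel "A i"] by simp
  then have "emeasure ?P (Pi\<^sub>E I (\<lambda>i. (\<lambda>y. c * y) -` A i)) = (\<Prod>i\<in>I. emeasure lborel ((\<lambda>y. c * y) -` A i))"
    by (intro lborel_product.emeasure_PiM fin)
  moreover have "emeasure ?D (Pi\<^sub>E I A) = ennreal (c ^ card I) * emeasure ?P (Pi\<^sub>E I (\<lambda>i. (\<lambda>y. c * y) -` A i))"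
    using AE meas by (simp add: emeasure_density_const emeasure_distr vim)
  moreover have "(\<Prod>i\<in>I. emeasure lborel (A i)) = (\<Prod>i\<in>I. ennreal c * emeasure lborel ((\<lambda>y. c * y) -` A i))"
    using A c by (intro prod.cong emeasure_lborel_scale) auto
  ultimately show "emeasure ?D (Pi\<^sub>E I A) = (\<Prod>i\<in>I. emeasure lborel (A i))"
    using c by (simp add: prod.distrib ennreal_power)
qed simp

lemma integral_PiM_lborel_scale:
  fixes c :: real and f :: "_ \<Rightarrow> complex"
  assumes fin: "finite I" and c: "c > 0" and f: "f \<in> borel_measurable (Pi\<^sub>M I (\<lambda>_. lborel))"
  shows "(\<integral>T. f T \<partial>Pi\<^sub>M I (\<lambda>_. lborel)) = of_real (c ^ card I) * (\<integral>T. f (\<lambda>i\<in>I. c * T i) \<partial>Pi\<^sub>M I (\<lambda>_. lborel))"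
proof -
  let ?P = "Pi\<^sub>M I (\<lambda>_. lborel :: real measure)"
  have meas: "(\<lambda>T. \<lambda>i\<in>I. c * T i) \<in> measurable ?P ?P"
    by (intro measurable_restrict) measurable
  have "(\<integral>T. f T \<partial>?P) = (\<integral>T. f T \<partial>density (distr ?P ?P (\<lambda>T. \<lambda>i\<in>I. c * T i)) (\<lambda>_. ennreal (c ^ card I)))"
    by (simp only: PiM_lborel_scale[OF fin c])
  also have "\<dots> = (\<integral>T. (c ^ card I) *\<^sub>R f T \<partial>distr ?P ?P (\<lambda>T. \<lambda>i\<in>I. c * T i))"
    using c f by (intro integral_density) auto
  also have "\<dots> = (\<integral>T. (c ^ card I) *\<^sub>R f (\<lambda>i\<in>I. c * T i) \<partial>?P)"
    using f meas by (intro integral_distr) auto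
  finally show ?thesis by (simp add: scaleR_conv_of_real)
qed

text \<open>The factor \<open>a\<close> in the parameters cancels the factor \<open>1 / a\<close> in
  the array, so the linear part is unchanged and only the walls feel the substitution.\<close>

lemma whittaker_scale:
  assumes a: "a > 0"
  shows "whittaker N (\<lambda>j. of_real a * \<nu> j) (\<lambda>j. x j / a) =
    of_real ((1 / a) ^ card (index_pairs N)) * gt_integral N (soft_wall a) \<nu> x"
proof -
  let ?I = "free_entries N"
  let ?y = "\<lambda>j. x j / a"
  have entry: "with_last_row N ?y (\<lambda>i\<in>?I. 1 / a * T i) (j, k) = with_last_row N x T (j, k) / a"
    if "1 \<le> k" "k \<le> j" "j \<le> N" for T j k
    using that by (auto simp: with_last_row_def free_entries_def)
  have 1: "gt_integrand N (soft_wall 1) (\<lambda>j. of_real a * \<nu> j) ?y (\<lambda>i\<in>?I. 1 / a * T i) =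
      gt_integrand N (soft_wall a) \<nu> x T" for T
  proof -
    let ?T = "with_last_row N x T" and ?T' = "with_last_row N ?y (\<lambda>i\<in>?I. 1 / a * T i)"
    have "gt_linear N (\<lambda>j. of_real a * \<nu> j) ?T' = gt_linear N (\<lambda>j. of_real a * \<nu> j) (\<lambda>p. ?T p / a)"
      by (rule gt_linear_cong) (rule entry)
    also have "\<dots> = gt_linear N \<nu> ?T"
      unfolding gt_linear_def using a
      by (intro sum.cong refl) (simp add: sum_divide_distrib[symmetric] diff_divide_distrib[symmetric])
    finally have lin: "gt_linear N (\<lambda>j. of_real a * \<nu> j) ?T' = gt_linear N \<nu> ?T" .
    have "gt_weight N (soft_wall 1) ?T' = gt_weight N (soft_wall 1) (\<lambda>p. ?T p / a)"
      by (rule gt_weight_cong) (rule entry)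
    also have "\<dots> = gt_weight N (soft_wall a) ?T"
      unfolding gt_weight_def soft_wall_def
      by (simp only: diff_divide_distrib[symmetric] minus_divide_left div_by_1)
    finally show ?thesis unfolding gt_integrand_def lin by simp
  qed
  have "whittaker N (\<lambda>j. of_real a * \<nu> j) ?y =
      (\<integral>T. gt_integrand N (soft_wall 1) (\<lambda>j. of_real a * \<nu> j) ?y T \<partial>Pi\<^sub>M ?I (\<lambda>_. lborel))"
    unfolding whittaker_def gt_integrand_soft ..
  also have "\<dots> = of_real ((1 / a) ^ card ?I) * (\<integral>T. gt_integrand N (soft_wall 1) (\<lambda>j. of_real a * \<nu> j) ?y
      (\<lambda>i\<in>?I. 1 / a * T i) \<partial>Pi\<^sub>M ?I (\<lambda>_. lborel))"
    using a by (intro integral_PiM_lborel_scale measurable_gt_integrand wall_soft) auto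
  finally show ?thesis
    unfolding gt_integral_def 1 card_free_entries .
qed

text \<open>Fubini with row \<open>N\<close> as the outer variable: once it is fixed, the rows below
  it form an array of size \<open>N\<close> with this row as its last.\<close>

lemma gt_integral_Suc:
  assumes w: "wall w"
  shows "gt_integral (Suc N) w \<nu> x =
    (\<integral>Y. exp (\<nu> (Suc N) * of_real ((\<Sum>k=1..Suc N. x k) - (\<Sum>k=1..N. Y (N, k)))) *
        of_real (\<Prod>k=1..N. w (Y (N, k) - x k) * w (x (Suc k) - Y (N, k))) *
        gt_integral N w \<nu> (\<lambda>k. Y (N, k)) \<partial>Pi\<^sub>M (Pair N ` {1..N}) (\<lambda>_. lborel))"
    (is "_ = (\<integral>Y. ?E Y * ?W Y * _ \<partial>_)")
proof -
  let ?J = "Pair N ` {1..N}" and ?I = "free_entries N"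
  have split: "gt_integrand (Suc N) w \<nu> x (merge ?J ?I (Y, S)) =
      ?E Y * ?W Y * gt_integrand N w \<nu> (\<lambda>k. Y (N, k)) S" for Y S
  proof -
    let ?T = "with_last_row (Suc N) x (merge ?J ?I (Y, S))"
    let ?T' = "with_last_row N (\<lambda>k. Y (N, k)) S"
    have T': "?T (j, k) = ?T' (j, k)" if "1 \<le> k" "k \<le> j" "j \<le> N" for j k
      using that by (auto simp: with_last_row_def merge_def free_entries_def)
    have rowN: "?T (N, k) = Y (N, k)" if "k \<in> {1..N}" for k
      using T'[of k N] that by (auto simp: with_last_row_def)
    have rowS: "?T (Suc N, k) = x k" for k by (simp add: with_last_row_def)
    have "gt_linear (Suc N) \<nu> ?T = gt_linear N \<nu> ?T' +
        \<nu> (Suc N) * of_real ((\<Sum>k=1..Suc N. x k) - (\<Sum>k=1..N. Y (N, k)))"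
      unfolding gt_linear_Suc rowS using gt_linear_cong[of N ?T ?T', OF T'] rowN by simp
    moreover have "gt_weight (Suc N) w ?T = gt_weight N w ?T' * (\<Prod>k=1..N. w (Y (N, k) - x k) * w (x (Suc k) - Y (N, k)))"
      unfolding gt_weight_Suc rowS using gt_weight_cong[of N ?T ?T', OF T'] rowN by simp
    ultimately show ?thesis
      unfolding gt_integrand_def by (simp add: exp_add)
  qed
  have "gt_integral (Suc N) w \<nu> x =
      (\<integral>Y. \<integral>S. gt_integrand (Suc N) w \<nu> x (merge ?J ?I (Y, S)) \<partial>Pi\<^sub>M ?I (\<lambda>_. lborel) \<partial>Pi\<^sub>M ?J (\<lambda>_. lborel))"
  proof -
    have "free_entries (Suc N) = ?J \<union> ?I" by (auto simp: free_entries_Suc)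
    then show ?thesis
      unfolding gt_integral_def using integrable_gt_integrand[OF w, of "Suc N" \<nu> x]
      by (simp only:) (intro lborel_product.product_integral_fold free_entries_disjoint; simp)
  qed
  then show ?thesis
    unfolding split gt_integral_def by simp
qed

text \<open>The factor \<open>\<mu>\<close> stays on the left so that \<open>\<mu> = 0\<close> is
  covered; this is how the determinant formula avoids any assumption of distinct parameters.\<close>

lemma integral_hard_wall_exp:
  fixes \<mu> :: complex
  assumes AB: "A \<le> B"
  defines "f \<equiv> \<lambda>y. of_real (hard_wall (y - A) * hard_wall (B - y)) * exp (\<mu> * of_real y)"
  shows "integrable lborel f" and "\<mu> * (\<integral>y. f y \<partial>lborel) = exp (\<mu> * of_real B) - exp (\<mu> * of_real A)"
proof -
  let ?g = "\<lambda>y. indicator {A..B} y *\<^sub>R exp (\<mu> * complex_of_real y)"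
  have cont: "continuous_on {A..B} (\<lambda>y. exp (\<mu> * complex_of_real y))"
    by (intro continuous_intros)
  have int: "integrable lborel ?g"
    using borel_integrable_atLeastAtMost'[OF cont] by (simp add: set_integrable_def)
  have [measurable]: "hard_wall \<in> borel_measurable borel"
    using wall_hard by (simp add: wall_def)
  have fm: "f \<in> borel_measurable lborel" unfolding f_def by measurable
  \<comment> \<open>The value \<open>exp (- 1)\<close> of the hard wall at \<open>0\<close> is felt
    only at the two endpoints, a null set.\<close>
  have ae: "AE y in lborel. ?g y = f y"
  proof -
    have "AE y in lborel. y \<noteq> A \<and> y \<noteq> B"
      using AE_lborel_singleton[of A] AE_lborel_singleton[of B] by eventually_elim auto
    then show ?thesis
      by eventually_elim (auto simp: f_def hard_wall_def)
  qed
  show "integrable lborel f"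
    using integrable_cong_AE[OF _ fm ae] int by (auto dest: borel_measurable_integrable)
  have "(\<integral>y. f y \<partial>lborel) = (\<integral>y. ?g y \<partial>lborel)"
    using integral_cong_AE[OF _ fm ae] int by (auto dest: borel_measurable_integrable)
  then have "\<mu> * (\<integral>y. f y \<partial>lborel) = (\<integral>y. indicator {A..B} y *\<^sub>R (\<mu> * exp (\<mu> * complex_of_real y)) \<partial>lborel)"
    by (subst integral_mult_right_zero[symmetric]) (simp add: scaleR_conv_of_real algebra_simps)
  also have "\<dots> = exp (\<mu> * of_real B) - exp (\<mu> * of_real A)"
  proof (rule integral_FTC_Icc[OF AB])
    show "((\<lambda>y. exp (\<mu> * complex_of_real y)) has_vector_derivative \<mu> * exp (\<mu> * complex_of_real y))
        (at y within {A..B})" for y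
      by (rule has_vector_derivative_real_field[of "\<lambda>z. exp (\<mu> * z)"]) (auto intro!: derivative_eq_intros)
  qed (intro continuous_intros)
  finally show "\<mu> * (\<integral>y. f y \<partial>lborel) = exp (\<mu> * of_real B) - exp (\<mu> * of_real A)" .
qed

text \<open>Subtracting \<open>\<nu> (Suc N)\<close> from all parameters makes the last row of the
  exponential determinant constant \<open>1\<close>. The determinant then equals one of size
  \<open>N\<close> whose columns are differences of neighbouring columns, and these differences are
  exactly the integrals of exponentials between neighbouring entries of \<open>x\<close>.\<close>

theorem vdm_gt_integral:
  assumes "mono_on {1..N} x"
  shows "vdm N \<nu> * gt_integral N hard_wall \<nu> x = idet N (\<lambda>j k. exp (\<nu> j * of_real (x k)))"
  using assms
proof (induction N arbitrary: x)
  case 0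
  have "free_entries 0 = {}" by (simp add: free_entries_def)
  then show ?case
    by (simp add: gt_integral_def gt_integrand_def gt_linear_def gt_weight_def idet_def PiM_empty lebesgue_integral_count_space_finite)
next
  case (Suc N)
  define \<mu> where "\<mu> j = \<nu> j - \<nu> (Suc N)" for j
  define h where "h k y = complex_of_real (hard_wall (y - x k) * hard_wall (x (Suc k) - y))" for k y
  define e where "e = exp (\<nu> (Suc N) * of_real (\<Sum>k=1..Suc N. x k))"
  let ?f = "\<lambda>j k y. h k y * exp (\<mu> j * complex_of_real y)"
  have le: "x k \<le> x (Suc k)" if "k \<in> {1..N}" for k
    using Suc.prems that by (auto simp: mono_on_def)
  have integrand: "vdm N \<nu> * (exp (\<nu> (Suc N) * of_real ((\<Sum>k=1..Suc N. x k) - (\<Sum>k=1..N. Y (N, k)))) *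
      of_real (\<Prod>k=1..N. hard_wall (Y (N, k) - x k) * hard_wall (x (Suc k) - Y (N, k))) *
      gt_integral N hard_wall \<nu> (\<lambda>k. Y (N, k))) = e * idet N (\<lambda>j k. ?f j k (Y (N, k)))" for Y
  proof -
    let ?y = "\<lambda>k. Y (N, k)"
    let ?c = "\<lambda>k. h k (?y k) * exp (- \<nu> (Suc N) * of_real (?y k))"
    have "idet N (\<lambda>j k. ?f j k (?y k)) = idet N (\<lambda>j k. 1 * ?c k * exp (\<nu> j * of_real (?y k)))"
      by (rule idet_cong) (simp add: \<mu>_def algebra_simps flip: exp_add)
    also have "\<dots> = (\<Prod>k=1..N. h k (?y k)) * (\<Prod>k=1..N. exp (- \<nu> (Suc N) * of_real (?y k))) *
        idet N (\<lambda>j k. exp (\<nu> j * of_real (?y k)))"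
      by (simp only: idet_scale prod.distrib) simp
    also have "(\<Prod>k=1..N. exp (- \<nu> (Suc N) * of_real (?y k))) = exp (- \<nu> (Suc N) * of_real (\<Sum>k=1..N. ?y k))"
      by (simp add: exp_sum[symmetric] sum_distrib_left sum_negf)
    also have "(\<Prod>k=1..N. h k (?y k)) * exp (- \<nu> (Suc N) * of_real (\<Sum>k=1..N. ?y k)) *
        idet N (\<lambda>j k. exp (\<nu> j * of_real (?y k))) =
        (\<Prod>k=1..N. h k (?y k)) * exp (- \<nu> (Suc N) * of_real (\<Sum>k=1..N. ?y k)) *
        (vdm N \<nu> * gt_integral N hard_wall \<nu> ?y)"
    \<comment> \<open>Where the walls do not vanish, the new row interlaces with the increasing
      \<open>x\<close> and is itself increasing, as the induction hypothesis requires; elsewhere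
      both sides are \<open>0\<close>.\<close>
    proof (cases "\<forall>k\<in>{1..N}. h k (?y k) \<noteq> 0")
      case True
      then have y: "x k \<le> ?y k" "?y k \<le> x (Suc k)" if "k \<in> {1..N}" for k
        using that by (fastforce simp: h_def hard_wall_def split: if_splits)+
      have "?y k \<le> ?y l" if "k \<in> {1..N}" "l \<in> {1..N}" "k \<le> l" for k l
      proof (cases "k = l")
        case False
        then have "x (Suc k) \<le> x l"
          using that Suc.prems by (auto simp: mono_on_def)
        then show ?thesis using y(2)[OF that(1)] y(1)[OF that(2)] by simp
      qed simp
      then have "mono_on {1..N} ?y" by (intro mono_onI) auto
      from Suc.IH[OF this] show ?thesis by simp
    next
      case False
      then have "(\<Prod>k=1..N. h k (?y k)) = 0" by (intro prod_zero) auto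
      then show ?thesis by simp
    qed
    finally show ?thesis
      by (simp add: e_def h_def right_diff_distrib exp_diff exp_minus divide_inverse)
  qed
  have "vdm (Suc N) \<nu> * gt_integral (Suc N) hard_wall \<nu> x =
      (\<Prod>j=1..N. \<nu> (Suc N) - \<nu> j) * (\<integral>Y. e * idet N (\<lambda>j k. ?f j k (Y (N, k))) \<partial>Pi\<^sub>M (Pair N ` {1..N}) (\<lambda>_. lborel))"
    unfolding vdm_Suc gt_integral_Suc[OF wall_hard] integrand[symmetric] integral_mult_right_zero
    by simp
  also have "\<dots> = e * ((\<Prod>j=1..N. \<nu> (Suc N) - \<nu> j) * idet N (\<lambda>j k. \<integral>y. ?f j k y \<partial>lborel))"
    unfolding integral_mult_right_zero
    by (subst integral_idet[of "Pair N" N ?f]) (use integral_hard_wall_exp(1)[OF le] in \<open>auto simp: inj_on_def h_def\<close>)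
  \<comment> \<open>The factors that \<open>vdm_Suc\<close> adds go into the rows, one each, where
    they remove the denominators of the exponential integrals. They equal \<open>- \<mu> j\<close>,
    and this sign turns each difference into left column minus right column.\<close>
  also have "(\<Prod>j=1..N. \<nu> (Suc N) - \<nu> j) * idet N (\<lambda>j k. \<integral>y. ?f j k y \<partial>lborel) =
      idet N (\<lambda>j k. (\<nu> (Suc N) - \<nu> j) * 1 * (\<integral>y. ?f j k y \<partial>lborel))"
    by (subst idet_scale) simp
  also have "\<dots> = idet N (\<lambda>j k. exp (\<mu> j * of_real (x k)) - exp (\<mu> j * of_real (x (Suc k))))"
  proof (rule idet_cong)
    fix j k assume "j \<in> {1..N}" "k \<in> {1..N}"
    have "(\<nu> (Suc N) - \<nu> j) * 1 * (\<integral>y. ?f j k y \<partial>lborel) = - (\<mu> j * (\<integral>y. ?f j k y \<partial>lborel))"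
      by (simp add: \<mu>_def algebra_simps)
    also have "\<mu> j * (\<integral>y. ?f j k y \<partial>lborel) = exp (\<mu> j * of_real (x (Suc k))) - exp (\<mu> j * of_real (x k))"
      unfolding h_def by (rule integral_hard_wall_exp(2)[OF le]) fact
    finally show "(\<nu> (Suc N) - \<nu> j) * 1 * (\<integral>y. ?f j k y \<partial>lborel) =
        exp (\<mu> j * of_real (x k)) - exp (\<mu> j * of_real (x (Suc k)))" by simp
  qed
  also have "\<dots> = idet (Suc N) (\<lambda>j k. exp (\<mu> j * of_real (x k)))"
    by (rule idet_last_row_ones[symmetric]) (simp add: \<mu>_def)
  also have "e * idet (Suc N) (\<lambda>j k. exp (\<mu> j * of_real (x k))) =
      idet (Suc N) (\<lambda>j k. 1 * exp (\<nu> (Suc N) * of_real (x k)) * exp (\<mu> j * of_real (x k)))"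
    unfolding idet_scale e_def of_real_sum sum_distrib_left by (simp add: exp_sum exp_add)
  also have "\<dots> = idet (Suc N) (\<lambda>j k. exp (\<nu> j * of_real (x k)))"
    by (rule idet_cong) (simp add: \<mu>_def algebra_simps flip: exp_add)
  finally show ?case .
qed

section \<open>Gaussian Fourier moments\<close>

lemma integrable_gaussian_moment_abs:
  assumes t: "(t::real) > 0"
  shows "integrable lborel (\<lambda>y. exp (- t * y\<^sup>2 / 2) * \<bar>y\<bar> ^ m)"
proof -
  have "integrable lborel (\<lambda>y. sqrt (2 * pi / t) * (normal_density 0 (1 / sqrt t) y * \<bar>y - 0\<bar> ^ m))"
    by (intro integrable_mult_right integrable_normal_moment_abs) (use t in simp)
  moreover have "sqrt (2 * pi / t) * (normal_density 0 (1 / sqrt t) y * \<bar>y - 0\<bar> ^ m) = exp (- t * y\<^sup>2 / 2) * \<bar>y\<bar> ^ m" for y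
    using t by (simp add: normal_density_def power_divide real_sqrt_divide real_sqrt_mult mult.commute)
  ultimately show ?thesis by (simp only:)
qed

text \<open>The Gaussian weight of a single spectral variable \<open>y\<close> times the exponential
  that the determinant formula yields at the parameter \<open>- \<i> * y\<close>.\<close>

definition gaussian_wave :: "real \<Rightarrow> real \<Rightarrow> real \<Rightarrow> complex" where
  "gaussian_wave t x y = of_real (exp (- t * y\<^sup>2 / 2)) * exp (- \<i> * of_real y * of_real x)"

lemma gaussian_wave_exp: "gaussian_wave t x y = exp (- of_real t * of_real y ^ 2 / 2 - \<i> * of_real x * of_real y)"
  unfolding gaussian_wave_def exp_of_real[symmetric] exp_add[symmetric]
  by (rule arg_cong[where f = exp]) (simp add: algebra_simps)

lemma norm_gaussian_wave: "cmod (gaussian_wave t x y) = exp (- t * y\<^sup>2 / 2)"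
  by (simp add: gaussian_wave_def norm_mult norm_exp_eq_Re)

lemma integrable_gaussian_wave:
  assumes t: "t > 0"
  shows "integrable lborel (\<lambda>y. gaussian_wave t x y * of_real y ^ m)"
proof (rule Bochner_Integration.integrable_bound[OF integrable_gaussian_moment_abs[OF t, of m]])
  show "(\<lambda>y. gaussian_wave t x y * of_real y ^ m) \<in> borel_measurable lborel"
    unfolding gaussian_wave_def by measurable
  show "AE y in lborel. norm (gaussian_wave t x y * complex_of_real y ^ m) \<le> norm (exp (- t * y\<^sup>2 / 2) * \<bar>y\<bar> ^ m)"
    by (rule AE_I2) (simp add: norm_mult norm_power norm_gaussian_wave abs_mult)
qed

definition gaussian_moment :: "real \<Rightarrow> nat \<Rightarrow> real \<Rightarrow> complex" where
  "gaussian_moment t m x = (\<integral>y. gaussian_wave t x y * of_real y ^ m \<partial>lborel)"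

text \<open>The characteristic function of the standard normal law at \<open>- x / sqrt t\<close>,
  after the substitution of \<open>sqrt t * y\<close> for \<open>y\<close>.\<close>

lemma gaussian_moment_0:
  assumes t: "t > 0"
  shows "gaussian_moment t 0 x = of_real (sqrt (2 * pi / t) * exp (- x\<^sup>2 / (2 * t)))"
proof -
  let ?s = "- x / sqrt t"
  let ?f = "\<lambda>y. std_normal_density y *\<^sub>R exp (\<i> * complex_of_real (?s * y))"
  have f: "?f (0 + sqrt t * y) = of_real (1 / sqrt (2 * pi)) * (gaussian_wave t x y * of_real y ^ 0)" for y
    using t by (simp add: gaussian_wave_def std_normal_density_def power_mult_distrib scaleR_conv_of_real algebra_simps)
  have "complex_of_real (exp (- ?s\<^sup>2 / 2)) = char std_normal_distribution ?s"
    by (simp add: char_std_normal_distribution)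
  also have "\<dots> = (\<integral>y. ?f y \<partial>lborel)"
    unfolding char_def by (subst integral_density) auto
  also have "\<dots> = \<bar>sqrt t\<bar> *\<^sub>R (\<integral>y. ?f (0 + sqrt t * y) \<partial>lborel)"
    by (rule lborel_integral_real_affine) (use t in simp)
  also have "\<dots> = \<bar>sqrt t\<bar> *\<^sub>R (\<integral>y. of_real (1 / sqrt (2 * pi)) * (gaussian_wave t x y * of_real y ^ 0) \<partial>lborel)"
    unfolding f ..
  finally have "complex_of_real (exp (- ?s\<^sup>2 / 2)) = of_real (sqrt t / sqrt (2 * pi)) * gaussian_moment t 0 x"
    using t by (simp add: gaussian_moment_def scaleR_conv_of_real)
  then have "complex_of_real (sqrt (2 * pi / t)) * of_real (exp (- ?s\<^sup>2 / 2)) =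
      of_real (sqrt (2 * pi / t) * (sqrt t / sqrt (2 * pi))) * gaussian_moment t 0 x"
    by simp
  also have "sqrt (2 * pi / t) * (sqrt t / sqrt (2 * pi)) = 1"
    using t by (simp add: real_sqrt_divide)
  finally show ?thesis
    using t by (simp add: power_divide mult.commute)
qed

lemma gaussian_power_tendsto:
  assumes t: "(t::real) > 0"
  shows "((\<lambda>y. exp (- t * y\<^sup>2 / 2) * \<bar>y\<bar> ^ m) \<longlongrightarrow> 0) at_top"
    and "((\<lambda>y. exp (- t * y\<^sup>2 / 2) * \<bar>y\<bar> ^ m) \<longlongrightarrow> 0) at_bot"
proof -
  show *: "((\<lambda>y. exp (- t * y\<^sup>2 / 2) * \<bar>y\<bar> ^ m) \<longlongrightarrow> 0) at_top"
    using t by real_asymp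
  show "((\<lambda>y. exp (- t * y\<^sup>2 / 2) * \<bar>y\<bar> ^ m) \<longlongrightarrow> 0) at_bot"
    using filterlim_compose[OF * filterlim_uminus_at_top_at_bot] by simp
qed

text \<open>Integration by parts.\<close>

lemma gaussian_moment_Suc:
  assumes t: "t > 0"
  shows "of_real t * gaussian_moment t (Suc m) x =
    of_nat m * gaussian_moment t (m - 1) x - \<i> * of_real x * gaussian_moment t m x"
proof -
  let ?F = "\<lambda>y. gaussian_wave t x y * of_real y ^ m"
  \<comment> \<open>The derivative of \<open>?F\<close>: one term each from the power, the Gaussian
    and the wave. For \<open>m = 0\<close> the truncated \<open>m - 1\<close> is harmless, as its
    coefficient vanishes.\<close>
  let ?f = "\<lambda>y. of_nat m * (gaussian_wave t x y * of_real y ^ (m - 1)) -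
      of_real t * (gaussian_wave t x y * of_real y ^ Suc m) - \<i> * of_real x * (gaussian_wave t x y * of_real y ^ m)"
  note iA = integrable_mult_right[OF integrable_gaussian_wave[OF t, of x "m - 1"], of "of_nat m"]
  note iB = integrable_mult_right[OF integrable_gaussian_wave[OF t, of x "Suc m"], of "of_real t"]
  note iC = integrable_mult_right[OF integrable_gaussian_wave[OF t, of x m], of "\<i> * of_real x"]
  have int: "integrable lborel ?f"
    by (rule Bochner_Integration.integrable_diff[OF Bochner_Integration.integrable_diff[OF iA iB] iC])
  have e: "einterval (-\<infinity>) \<infinity> = UNIV" by (auto simp: einterval_def)
  have "(LBINT y=-\<infinity>..\<infinity>. ?f y) = 0 - 0"
  proof (rule interval_integral_FTC_integrable)
    fix y
    let ?z = "complex_of_real y"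
    have alg: "e * (- c * z - w) * p + n * q * e = n * (e * q) - c * (e * (z * p)) - w * (e * p)"
      for e c z w p n q :: complex
      by (simp add: algebra_simps)
    \<comment> \<open>The derivative is computed for the holomorphic extension to complex arguments
      and then restricted to the real line.\<close>
    define E where "E z = exp (- of_real t * z ^ 2 / 2 - \<i> * of_real x * z)" for z
    have "(E has_field_derivative E ?z * (- of_real t * ?z - \<i> * of_real x)) (at ?z)"
      unfolding E_def by (rule derivative_eq_intros refl | simp)+
    then have "((\<lambda>z. E z * z ^ m) has_field_derivative
        E ?z * (- of_real t * ?z - \<i> * of_real x) * ?z ^ m + of_nat m * ?z ^ (m - 1) * E ?z) (at ?z)"
      by (rule DERIV_mult) (auto intro!: derivative_eq_intros)
    also have "E ?z * (- of_real t * ?z - \<i> * of_real x) * ?z ^ m + of_nat m * ?z ^ (m - 1) * E ?z = ?f y"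
      unfolding gaussian_wave_exp E_def[symmetric] power_Suc by (rule alg)
    finally have "((\<lambda>z. exp (- of_real t * z ^ 2 / 2 - \<i> * of_real x * z) * z ^ m) has_field_derivative ?f y) (at ?z)"
      unfolding E_def .
    from has_vector_derivative_real_field[OF this]
    show "(?F has_vector_derivative ?f y) (at y)"
      by (simp add: gaussian_wave_exp)
    show "isCont ?f y"
      unfolding gaussian_wave_def by (intro continuous_intros) simp_all
  next
    show "set_integrable lborel (einterval (-\<infinity>) \<infinity>) ?f"
      using int by (simp add: set_integrable_def e)
  next
    have *: "norm (?F y) = exp (- t * y\<^sup>2 / 2) * \<bar>y\<bar> ^ m" for y
      by (simp add: norm_mult norm_power norm_gaussian_wave)
    have "(?F \<longlongrightarrow> 0) at_bot"
      by (rule tendsto_norm_zero_cancel) (simp only: * gaussian_power_tendsto[OF t])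
    then show "((?F \<circ> real_of_ereal) \<longlongrightarrow> 0) (at_right (-\<infinity>))"
      by (simp add: ereal_tendsto_simps)
    have "(?F \<longlongrightarrow> 0) at_top"
      by (rule tendsto_norm_zero_cancel) (simp only: * gaussian_power_tendsto[OF t])
    then show "((?F \<circ> real_of_ereal) \<longlongrightarrow> 0) (at_left \<infinity>)"
      by (simp add: ereal_tendsto_simps)
  qed simp
  then have "(\<integral>y. ?f y \<partial>lborel) = 0"
    unfolding interval_lebesgue_integral_def set_lebesgue_integral_def e by simp
  also have "(\<integral>y. ?f y \<partial>lborel) = of_nat m * gaussian_moment t (m - 1) x -
      of_real t * gaussian_moment t (Suc m) x - \<i> * of_real x * gaussian_moment t m x"
    unfolding gaussian_moment_def
    by (simp only: Bochner_Integration.integral_diff[OF Bochner_Integration.integrable_diff[OF iA iB] iC]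
        Bochner_Integration.integral_diff[OF iA iB] integral_mult_right_zero)
  finally show ?thesis by (simp add: algebra_simps)
qed

text \<open>These are rescaled Hermite polynomials. In the recursion only the term containing
  \<open>x\<close> raises the degree, multiplying the leading coefficient by
  \<open>- \<i> / t\<close>; this coefficient is recorded because it alone survives in the
  determinant.\<close>

lemma gaussian_moment_poly:
  assumes t: "t > 0"
  shows "\<exists>p. degree p \<le> m \<and> coeff p m = (- \<i> / of_real t) ^ m \<and>
    (\<forall>x. gaussian_moment t m x = gaussian_moment t 0 x * poly p (of_real x))"
proof -
  have rec: "gaussian_moment t (Suc m) x =
    (of_nat m * gaussian_moment t (m - 1) x - \<i> * of_real x * gaussian_moment t m x) / of_real t" for m x
    using gaussian_moment_Suc[OF t, of m x] t by (simp add: field_simps)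
  show ?thesis
  proof (induction m rule: less_induct)
    case (less m)
    show ?case
    proof (cases m)
      case 0
      then show ?thesis by (intro exI[of _ "[:1:]"]) simp
    next
      case (Suc n)
      obtain p where p: "degree p \<le> n" "coeff p n = (- \<i> / of_real t) ^ n"
        "\<And>x. gaussian_moment t n x = gaussian_moment t 0 x * poly p (of_real x)"
        using less[of n] Suc by auto
      have "n - 1 < m" using Suc by simp
      from less[OF this] obtain q where q: "degree q \<le> n - 1"
        "\<And>x. gaussian_moment t (n - 1) x = gaussian_moment t 0 x * poly q (of_real x)"
        by auto
      from q(1) have dq: "degree (Polynomial.smult (of_nat n) q) \<le> m" "coeff q m = 0"
        using Suc by (auto intro: order_trans[OF degree_smult_le] intro!: coeff_eq_0)
      let ?r = "Polynomial.smult (1 / of_real t) (Polynomial.smult (of_nat n) q - Polynomial.smult \<i> (pCons 0 p))"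
      have dp: "degree (Polynomial.smult \<i> (pCons 0 p)) \<le> m"
        using p(1) Suc degree_pCons_le[of 0 p] by (intro order_trans[OF degree_smult_le]) simp
      have "degree ?r \<le> m"
        by (rule order_trans[OF degree_smult_le degree_diff_le[OF dq(1) dp]])
      moreover have "coeff ?r m = (- \<i> / of_real t) ^ m"
        using dq(2) p(2) unfolding Suc by simp
      moreover have "gaussian_moment t m x = gaussian_moment t 0 x * poly ?r (of_real x)" for x
        unfolding Suc rec q(2) p(3) by (simp add: algebra_simps diff_divide_distrib)
      ultimately show ?thesis by blast
    qed
  qed
qed

section \<open>Evaluation of the limiting spectral integral\<close>

lemma prod_power_index_pairs: "(\<Prod>j=1..N. c ^ (j - 1)) = (c::'a::comm_ring_1) ^ card (index_pairs N)"
  using prod_index_pairs[of "\<lambda>_ _. c" N] by simp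

lemma vdm_scale: "vdm N (\<lambda>j. c * x j) = c ^ card (index_pairs N) * vdm N x"
proof -
  have "vdm N (\<lambda>j. c * x j) = (\<Prod>p\<in>index_pairs N. c * (case p of (j, l) \<Rightarrow> x l - x j))"
    unfolding vdm_def by (intro prod.cong) (auto simp: algebra_simps)
  then show ?thesis by (simp add: prod.distrib vdm_def)
qed

lemma vdm_of_real: "vdm N (\<lambda>j. of_real (x j)) = complex_of_real (vdm N x)"
  by (simp add: vdm_def case_prod_beta)

lemma idet_gaussian_moment:
  assumes t: "t > 0"
  shows "idet N (\<lambda>j k. gaussian_moment t (k - 1) (x j)) =
    (\<Prod>j=1..N. gaussian_moment t 0 (x j)) * (- \<i> / of_real t) ^ card (index_pairs N) * of_real (vdm N x)"
proof -
  obtain p where p: "\<And>m. degree (p m) \<le> m" "\<And>m. coeff (p m) m = (- \<i> / of_real t) ^ m"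
    "\<And>m x. gaussian_moment t m x = gaussian_moment t 0 x * poly (p m) (of_real x)"
    using gaussian_moment_poly[OF t] by metis
  have "idet N (\<lambda>j k. gaussian_moment t (k - 1) (x j)) =
      idet N (\<lambda>j k. 1 * gaussian_moment t 0 (x k) * poly (p (j - 1)) (of_real (x k)))"
    by (subst idet_transpose[symmetric]) (subst p(3), simp)
  also have "\<dots> = (\<Prod>j=1..N. gaussian_moment t 0 (x j)) *
      idet N (\<lambda>j k. poly (p (j - 1)) (of_real (x k)))"
    unfolding idet_scale by simp
  also have "idet N (\<lambda>j k. poly (p (j - 1)) (of_real (x k))) =
      (\<Prod>j=1..N. coeff (p (j - 1)) (j - 1)) * vdm N (\<lambda>k. complex_of_real (x k))"
    using le_less_trans[OF p(1)] by (intro idet_poly) auto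
  finally show ?thesis
    by (simp only: p(2) prod_power_index_pairs vdm_of_real mult.assoc)
qed

text \<open>One factor \<open>vdm N k\<close> turns \<open>gt_integral\<close> into a determinant of
  plane waves, the other is a determinant of powers, and the two are paired by Andreief's identity.
  The power of \<open>\<i>\<close> that relates the Vandermonde products at
  \<open>- \<i> * k\<close> and at \<open>k\<close> cancels against the leading coefficients of the
  moment polynomials.\<close>

theorem integral_gt_integral_gaussian:
  assumes t: "t > 0" and x: "mono_on {1..N} x"
  shows "(\<integral>k. of_real (exp (- t * norm_sq N k / 2)) * gt_integral N hard_wall (\<lambda>j. - \<i> * of_real (k j)) x *
      of_real ((vdm N k)\<^sup>2) \<partial>Pi\<^sub>M {1..N} (\<lambda>_. lborel)) =
    fact N * (\<Prod>j=1..N. of_real (sqrt (2 * pi / t) * exp (- (x j)\<^sup>2 / (2 * t)))) *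
      of_real (vdm N x / t ^ card (index_pairs N))"
proof -
  let ?M = "card (index_pairs N)"
  let ?w = "\<lambda>y. complex_of_real (exp (- t * y\<^sup>2 / 2))"
  let ?f = "\<lambda>l y. exp (- \<i> * complex_of_real y * of_real (x l))"
  let ?g = "\<lambda>l y. complex_of_real y ^ (l - 1)"
  have iM: "\<i> ^ n * (- \<i>) ^ n = 1" for n
    by (simp flip: power_mult_distrib)
  have eq: "of_real (exp (- t * norm_sq N k / 2)) * gt_integral N hard_wall (\<lambda>j. - \<i> * of_real (k j)) x * of_real ((vdm N k)\<^sup>2) =
      \<i> ^ ?M * ((\<Prod>j=1..N. ?w (k j)) * idet N (\<lambda>j l. ?f l (k j)) * idet N (\<lambda>j l. ?g l (k j)))" for k
  proof -
    have "gt_integral N hard_wall (\<lambda>j. - \<i> * of_real (k j)) x * of_real (vdm N k) =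
        \<i> ^ ?M * (vdm N (\<lambda>j. - \<i> * of_real (k j)) * gt_integral N hard_wall (\<lambda>j. - \<i> * of_real (k j)) x)"
      unfolding vdm_scale vdm_of_real using iM[of ?M] by (simp add: algebra_simps)
    also have "\<dots> = \<i> ^ ?M * idet N (\<lambda>j l. ?f l (k j))"
      unfolding vdm_gt_integral[OF x] ..
    finally have 1: "gt_integral N hard_wall (\<lambda>j. - \<i> * of_real (k j)) x * of_real (vdm N k) = \<i> ^ ?M * idet N (\<lambda>j l. ?f l (k j))" .
    have 2: "idet N (\<lambda>j l. ?g l (k j)) = of_real (vdm N k)"
      by (subst idet_transpose[symmetric]) (simp only: idet_powers vdm_of_real)
    have 3: "(\<Prod>j=1..N. ?w (k j)) = of_real (exp (- t * norm_sq N k / 2))"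
      by (simp add: norm_sq_def exp_sum[symmetric] sum_negf sum_distrib_left sum_divide_distrib flip: of_real_prod)
    have alg: "w * g * (v * v) = i * (w * d * v)" if "g * v = i * d" for w g v i d :: complex
    proof -
      have "w * g * (v * v) = w * v * (g * v)" by (simp only: mult_ac)
      then show ?thesis unfolding that by (simp only: mult_ac)
    qed
    show ?thesis
      unfolding 2 3 power2_eq_square[of "vdm N k"] of_real_mult[of "vdm N k"] using 1 by (rule alg)
  qed
  have "(\<integral>k. of_real (exp (- t * norm_sq N k / 2)) * gt_integral N hard_wall (\<lambda>j. - \<i> * of_real (k j)) x *
      of_real ((vdm N k)\<^sup>2) \<partial>Pi\<^sub>M {1..N} (\<lambda>_. lborel)) =
    \<i> ^ ?M * (fact N * idet N (\<lambda>j l. \<integral>y. ?w y * ?f j y * ?g l y \<partial>lborel))"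
    unfolding eq integral_mult_right_zero
    using integrable_gaussian_wave[OF t] unfolding gaussian_wave_def
    by (subst andreief_identity) auto
  also have "idet N (\<lambda>j l. \<integral>y. ?w y * ?f j y * ?g l y \<partial>lborel) = idet N (\<lambda>j l. gaussian_moment t (l - 1) (x j))"
    unfolding gaussian_moment_def gaussian_wave_def ..
  also have "\<dots> = (\<Prod>j=1..N. gaussian_moment t 0 (x j)) * (- \<i> / of_real t) ^ ?M * of_real (vdm N x)"
    by (rule idet_gaussian_moment[OF t])
  also have "(- \<i> / of_real t) ^ ?M = (- \<i>) ^ ?M / of_real (t ^ ?M)"
    by (simp only: power_divide of_real_power)
  also have "\<i> ^ ?M * (fact N * ((\<Prod>j=1..N. gaussian_moment t 0 (x j)) * ((- \<i>) ^ ?M / of_real (t ^ ?M)) * of_real (vdm N x))) =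
      (\<i> ^ ?M * (- \<i>) ^ ?M) * (fact N * (\<Prod>j=1..N. gaussian_moment t 0 (x j)) * of_real (vdm N x / t ^ ?M))"
    by simp
  finally show ?thesis
    unfolding iM gaussian_moment_0[OF t] by simp
qed

section \<open>The spectral integral\<close>

text \<open>What remains of \<open>1 / \<bar>Gamma (\<i> * u)\<bar>\<^sup>2\<close> after its double
  zero at \<open>0\<close> is split off. The entire function \<open>rGamma\<close> makes it
  continuous, with value \<open>1\<close> at \<open>0\<close>.\<close>

definition sklyanin_factor :: "real \<Rightarrow> real" where
  "sklyanin_factor u = (cmod (rGamma (1 + \<i> * of_real u)))\<^sup>2"

lemma inverse_Gamma_sq: "inverse ((cmod (Gamma (\<i> * of_real u)))\<^sup>2) = u\<^sup>2 * sklyanin_factor u"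
proof -
  have "inverse (Gamma (\<i> * of_real u)) = \<i> * of_real u * rGamma (1 + \<i> * of_real u)"
    using rGamma_plus1[of "\<i> * of_real u"] by (simp add: rGamma_inverse_Gamma add.commute)
  then have "cmod (inverse (Gamma (\<i> * of_real u))) = \<bar>u\<bar> * cmod (rGamma (1 + \<i> * of_real u))"
    by (simp add: norm_mult)
  then show ?thesis
    by (simp add: norm_inverse sklyanin_factor_def power_mult_distrib flip: power_inverse)
qed

lemma continuous_sklyanin_factor: "isCont sklyanin_factor u"
  unfolding sklyanin_factor_def by (intro continuous_intros) 

lemma sklyanin_factor_0: "sklyanin_factor 0 = 1"
  by (simp add: sklyanin_factor_def)

lemma sklyanin_factor_nonneg: "0 \<le> sklyanin_factor u"
  by (simp add: sklyanin_factor_def)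

text \<open>The reflection formula gives \<open>sklyanin_factor u = sinh (pi * u) / (pi * u)\<close>.\<close>

lemma sklyanin_factor_le: "sklyanin_factor u \<le> exp (pi * \<bar>u\<bar>)"
proof (cases "u = 0")
  case False
  let ?z = "\<i> * complex_of_real u"
  \<comment> \<open>Conjugation exchanges \<open>1 + \<i> * u\<close> and
    \<open>1 - \<i> * u\<close>, which brings the squared modulus into the form of the reflection
    formula.\<close>
  have "of_real (sklyanin_factor u) = rGamma (1 + ?z) * cnj (rGamma (1 + ?z))"
    unfolding sklyanin_factor_def complex_norm_square by simp
  also have "cnj (rGamma (1 + ?z)) = rGamma (1 - ?z)"
    by (simp add: cnj_rGamma)
  finally have "?z * of_real (sklyanin_factor u) = rGamma ?z * rGamma (1 - ?z)"
    using rGamma_plus1[of ?z] by (simp add: add.commute mult.assoc[symmetric])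
  also have "\<dots> = sin (of_real pi * ?z) / of_real pi"
    by (rule rGamma_reflection_complex)
  finally have eq: "\<bar>u\<bar> * sklyanin_factor u = cmod (sin (of_real pi * ?z)) / pi"
    using sklyanin_factor_nonneg[of u]
    by (metis (no_types, opaque_lifting) abs_of_nonneg norm_divide norm_ii norm_mult norm_of_real mult_1 pi_ge_zero)
  define v where "v = pi * \<bar>u\<bar>"
  have v: "v > 0" using False by (simp add: v_def)
  have "cmod (sin (of_real pi * ?z)) = \<bar>exp (- (pi * u)) - exp (pi * u)\<bar> / 2"
  proof -
    have "sin (of_real pi * ?z) = of_real (exp (- (pi * u)) - exp (pi * u)) / (2 * \<i>)"
      by (simp add: sin_exp_eq exp_of_real[symmetric] algebra_simps)
    then show ?thesis by (simp only: norm_divide norm_mult norm_of_real norm_ii) simp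
  qed
  also have "\<dots> = (exp v - exp (- v)) / 2"
  proof (cases "u > 0")
    case True
    then have "exp (- (pi * u)) \<le> exp (pi * u)" by simp
    then show ?thesis using True by (simp add: v_def)
  next
    case False
    then have "exp (pi * u) \<le> exp (- (pi * u))" using mult_nonneg_nonpos[of pi u] by simp
    then show ?thesis using False by (simp add: v_def)
  qed
  \<comment> \<open>This is \<open>sinh v \<le> v * exp v\<close>, that is,
    \<open>1 - exp (- 2 * v) \<le> 2 * v\<close> multiplied by \<open>exp v / 2\<close>.\<close>
  also have "\<dots> \<le> v * exp v"
  proof -
    have "1 - exp (- 2 * v) \<le> 2 * v"
      using exp_ge_add_one_self[of "- 2 * v"] by simp
    then have "exp v * (1 - exp (- 2 * v)) \<le> exp v * (2 * v)"
      by (intro mult_left_mono) auto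
    moreover have "exp v * exp (- 2 * v) = exp (- v)"
      by (simp flip: exp_add)
    ultimately show ?thesis by (simp add: right_diff_distrib mult.commute mult.left_commute)
  qed
  finally have "\<bar>u\<bar> * sklyanin_factor u \<le> \<bar>u\<bar> * exp v"
    unfolding eq using pi_gt_zero by (simp add: v_def field_simps)
  then show ?thesis using False by (simp add: v_def)
qed (simp add: sklyanin_factor_0)

text \<open>The Sklyanin density at \<open>a * k\<close> without its constant and its power of
  \<open>a\<close>. It makes sense at \<open>a = 0\<close> as well, where it is the squared
  Vandermonde product.\<close>

definition sklyanin_ratio :: "nat \<Rightarrow> real \<Rightarrow> (nat \<Rightarrow> real) \<Rightarrow> real" where
  "sklyanin_ratio N a k = (\<Prod>(j, l)\<in>index_pairs N. (k l - k j)\<^sup>2 * sklyanin_factor (a * (k l - k j)))"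

lemma sklyanin_scale:
  "sklyanin N (\<lambda>j. a * k j) = 1 / ((2 * pi) ^ N * fact N) * (a ^ card (index_pairs N))\<^sup>2 * sklyanin_ratio N a k"
proof -
  have "(\<Prod>(j, l)\<in>index_pairs N. inverse ((cmod (Gamma (\<i> * complex_of_real (a * k l - a * k j))))\<^sup>2)) =
      (\<Prod>p\<in>index_pairs N. a\<^sup>2 * (case p of (j, l) \<Rightarrow> (k l - k j)\<^sup>2 * sklyanin_factor (a * (k l - k j))))"
    unfolding inverse_Gamma_sq right_diff_distrib[symmetric] power_mult_distrib
    by (intro prod.cong) auto
  then show ?thesis
    unfolding sklyanin_def sklyanin_ratio_def
    by (simp add: prod.distrib power_mult[symmetric] mult.commute)
qed

lemma sklyanin_ratio_0: "sklyanin_ratio N 0 k = (vdm N k)\<^sup>2"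
  unfolding sklyanin_ratio_def vdm_def prod_power_distrib
  by (simp add: sklyanin_factor_0 prod_power_distrib[symmetric] case_prod_beta)

lemma sklyanin_ratio_tendsto:
  assumes "a \<longlonglongrightarrow> 0"
  shows "(\<lambda>n. sklyanin_ratio N (a n) k) \<longlonglongrightarrow> (vdm N k)\<^sup>2"
proof -
  have "(\<lambda>n. sklyanin_factor (a n * c)) \<longlonglongrightarrow> sklyanin_factor (0 * c)" for c
    by (intro isCont_tendsto_compose[OF continuous_sklyanin_factor] tendsto_mult tendsto_const assms)
  then show ?thesis
    unfolding sklyanin_ratio_0[symmetric] sklyanin_ratio_def case_prod_beta
    by (intro tendsto_prod tendsto_mult tendsto_const)
qed

lemma sklyanin_ratio_nonneg: "0 \<le> sklyanin_ratio N a k"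
  unfolding sklyanin_ratio_def by (intro prod_nonneg) (auto intro!: mult_nonneg_nonneg sklyanin_factor_nonneg)

text \<open>For a difference of size \<open>d\<close> the square is at most
  \<open>2 * exp d\<close>, and the Sklyanin factor at most
  \<open>exp (pi * a * d) \<le> exp (4 * d)\<close>. Since \<open>d\<close> is at most twice the sum
  of all \<open>\<bar>k j\<bar>\<close>, the total \<open>5 * d\<close> gives the \<open>10\<close>
  in the exponent.\<close>

lemma sklyanin_ratio_bound:
  fixes k :: "nat \<Rightarrow> real"
  assumes a: "0 \<le> a" "a \<le> 1"
  shows "sklyanin_ratio N a k \<le> 2 ^ card (index_pairs N) * exp (10 * card (index_pairs N) * (\<Sum>j=1..N. \<bar>k j\<bar>))"
proof -
  let ?S = "\<Sum>j=1..N. \<bar>k j\<bar>"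
  have factor: "(k l - k j)\<^sup>2 * sklyanin_factor (a * (k l - k j)) \<le> 2 * exp (10 * ?S)"
    if "(j, l) \<in> index_pairs N" for j l
  proof -
    define d where "d = \<bar>k l - k j\<bar>"
    have "\<bar>k l\<bar> \<le> ?S" "\<bar>k j\<bar> \<le> ?S"
      using that by (auto simp: index_pairs_def intro!: member_le_sum)
    then have dS: "d \<le> 2 * ?S" unfolding d_def by linarith
    have d0: "d \<ge> 0" by (simp add: d_def)
    have "(k l - k j)\<^sup>2 \<le> 2 * exp d"
      using exp_lower_Taylor_quadratic[OF d0] d0 unfolding d_def by simp
    moreover have "sklyanin_factor (a * (k l - k j)) \<le> exp (4 * d)"
    proof -
      have "a * d \<le> 1 * d" using a d0 by (intro mult_right_mono)
      then have "pi * (a * d) \<le> 4 * d" using a d0 pi_less_4 by (intro mult_mono) auto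
      then have "exp (pi * \<bar>a * (k l - k j)\<bar>) \<le> exp (4 * d)" using a by (simp add: d_def abs_mult)
      then show ?thesis using sklyanin_factor_le order_trans by blast
    qed
    ultimately have "(k l - k j)\<^sup>2 * sklyanin_factor (a * (k l - k j)) \<le> (2 * exp d) * exp (4 * d)"
      by (intro mult_mono sklyanin_factor_nonneg) auto
    also have "\<dots> = 2 * exp (5 * d)" by (simp flip: exp_add)
    also have "\<dots> \<le> 2 * exp (10 * ?S)" using dS by simp
    finally show ?thesis .
  qed
  have "sklyanin_ratio N a k \<le> (\<Prod>p\<in>index_pairs N. 2 * exp (10 * ?S))"
    unfolding sklyanin_ratio_def
  proof (rule prod_mono)
    fix p assume "p \<in> index_pairs N"
    then show "0 \<le> (case p of (j, l) \<Rightarrow> (k l - k j)\<^sup>2 * sklyanin_factor (a * (k l - k j))) \<and>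
        (case p of (j, l) \<Rightarrow> (k l - k j)\<^sup>2 * sklyanin_factor (a * (k l - k j))) \<le> 2 * exp (10 * ?S)"
      using factor by (cases p) (simp add: sklyanin_factor_nonneg)
  qed
  also have "\<dots> = 2 ^ card (index_pairs N) * exp (10 * card (index_pairs N) * ?S)"
    by (simp add: power_mult_distrib exp_of_nat_mult[symmetric] algebra_simps)
  finally show ?thesis .
qed

lemma measurable_sklyanin_ratio:
  "sklyanin_ratio N a \<in> borel_measurable (Pi\<^sub>M {1..N} (\<lambda>_. lborel))"
  unfolding sklyanin_ratio_def
proof (intro borel_measurable_prod)
  fix p assume "p \<in> index_pairs N"
  then obtain j l where p: "p = (j, l)" "j \<in> {1..N}" "l \<in> {1..N}" by (auto simp: index_pairs_def)
  have [measurable]: "sklyanin_factor \<in> borel_measurable borel"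
    by (intro borel_measurable_continuous_onI continuous_at_imp_continuous_on ballI continuous_sklyanin_factor)
  have [measurable]: "(\<lambda>k. k j) \<in> borel_measurable (Pi\<^sub>M {1..N} (\<lambda>_. lborel :: real measure))"
    "(\<lambda>k. k l) \<in> borel_measurable (Pi\<^sub>M {1..N} (\<lambda>_. lborel :: real measure))"
    using measurable_component_singleton[OF p(2), of "\<lambda>_. lborel :: real measure"]
      measurable_component_singleton[OF p(3), of "\<lambda>_. lborel :: real measure"] by simp_all
  show "(\<lambda>k. case p of (j, l) \<Rightarrow> (k l - k j)\<^sup>2 * sklyanin_factor (a * (k l - k j)))
      \<in> borel_measurable (Pi\<^sub>M {1..N} (\<lambda>_. lborel))"
    unfolding p prod.case by measurable
qed

lemma measurable_norm_sq [measurable]: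
  "norm_sq N \<in> borel_measurable (Pi\<^sub>M {1..N} (\<lambda>_. lborel))"
  unfolding norm_sq_def
proof (intro borel_measurable_sum)
  fix j assume "j \<in> {1..N}"
  from measurable_component_singleton[OF this, of "\<lambda>_. lborel :: real measure"]
  show "(\<lambda>k. (k j)\<^sup>2) \<in> borel_measurable (Pi\<^sub>M {1..N} (\<lambda>_. lborel :: real measure))" by simp
qed

lemma measurable_gt_integral:
  assumes "wall w"
  shows "(\<lambda>k. gt_integral N w (\<lambda>j. - \<i> * of_real (k j)) x) \<in> borel_measurable (Pi\<^sub>M {1..N} (\<lambda>_. lborel))"
proof -
  interpret finite_product_sigma_finite "\<lambda>_. lborel :: real measure" "free_entries N"
    by standard simp
  have "(\<lambda>k. - \<i> * of_real (k j)) \<in> borel_measurable (Pi\<^sub>M {1..N} (\<lambda>_. lborel :: real measure))" if "j \<in> {1..N}" for j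
    using measurable_component_singleton[OF that, of "\<lambda>_. lborel :: real measure"] by simp
  from measurable_gt_integrand_pair[OF assms this]
  show ?thesis
    unfolding gt_integral_def by (intro borel_measurable_lebesgue_integral) simp
qed

text \<open>Half of the Gaussian absorbs the linear exponent, by completing the square in
  \<open>t * \<bar>y\<bar> / 2 - c\<close>; the other half remains integrable.\<close>

lemma integrable_gaussian_exp_abs:
  assumes t: "(t::real) > 0"
  shows "integrable lborel (\<lambda>y. exp (- t * y\<^sup>2 / 2 + c * \<bar>y\<bar>))"
proof (rule Bochner_Integration.integrable_bound)
  show "integrable lborel (\<lambda>y. exp (c\<^sup>2 / t) * (exp (- (t / 2) * y\<^sup>2 / 2) * \<bar>y\<bar> ^ 0))"
    by (intro integrable_mult_right integrable_gaussian_moment_abs) (use t in simp)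
  show "AE y in lborel. norm (exp (- t * y\<^sup>2 / 2 + c * \<bar>y\<bar>)) \<le>
      norm (exp (c\<^sup>2 / t) * (exp (- (t / 2) * y\<^sup>2 / 2) * \<bar>y\<bar> ^ 0))"
  proof (rule AE_I2)
    fix y :: real
    have "0 \<le> (t * \<bar>y\<bar> / 2 - c)\<^sup>2 / t" using t by simp
    also have "\<dots> = t * y\<^sup>2 / 4 - c * \<bar>y\<bar> + c\<^sup>2 / t"
      using t by (simp add: power2_eq_square field_simps)
    finally have "- t * y\<^sup>2 / 2 + c * \<bar>y\<bar> \<le> c\<^sup>2 / t + - (t / 2) * y\<^sup>2 / 2"
      by simp
    then show "norm (exp (- t * y\<^sup>2 / 2 + c * \<bar>y\<bar>)) \<le>
      norm (exp (c\<^sup>2 / t) * (exp (- (t / 2) * y\<^sup>2 / 2) * \<bar>y\<bar> ^ 0))"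
      by (simp only: exp_add[symmetric] power_0 mult_1_right real_norm_def abs_exp_cancel exp_le_cancel_iff)
  qed
  show "(\<lambda>y. exp (- t * y\<^sup>2 / 2 + c * \<bar>y\<bar>)) \<in> borel_measurable lborel" by measurable
qed

lemma integrable_gaussian_exp_sum:
  assumes t: "t > 0"
  shows "integrable (Pi\<^sub>M {1..N} (\<lambda>_. lborel))
    (\<lambda>k. exp (- t * norm_sq N k / 2) * exp (c * (\<Sum>j=1..N. \<bar>k j\<bar>)))"
proof -
  have "integrable (Pi\<^sub>M {1..N} (\<lambda>_. lborel)) (\<lambda>k. \<Prod>j\<in>{1..N}. exp (- t * (k j)\<^sup>2 / 2 + c * \<bar>k j\<bar>))"
    by (rule lborel_product.product_integrable_prod[where f = "\<lambda>_ y. exp (- t * y\<^sup>2 / 2 + c * \<bar>y\<bar>)",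
        OF _ integrable_gaussian_exp_abs[OF t]]) simp
  moreover have "(\<Prod>j\<in>{1..N}. exp (- t * (k j)\<^sup>2 / 2 + c * \<bar>k j\<bar>)) =
      exp (- t * norm_sq N k / 2) * exp (c * (\<Sum>j=1..N. \<bar>k j\<bar>))" for k
  proof -
    have "(\<Sum>j=1..N. - t * (k j)\<^sup>2 / 2 + c * \<bar>k j\<bar>) = - t * norm_sq N k / 2 + c * (\<Sum>j=1..N. \<bar>k j\<bar>)"
      unfolding norm_sq_def by (simp only: sum.distrib sum_distrib_left sum_divide_distrib)
    then show ?thesis by (simp only: exp_add[symmetric] exp_sum[symmetric] finite_atLeastAtMost)
  qed
  ultimately show ?thesis by (simp only:)
qed

text \<open>The parameters are imaginary, so the strip has width \<open>L = 0\<close> and the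
  dominating function is the same for all \<open>k\<close>.\<close>

lemma norm_gt_integral_imaginary_le:
  "\<exists>B\<ge>0. \<forall>w k. wall w \<longrightarrow> cmod (gt_integral N w (\<lambda>j. - \<i> * of_real (k j)) x) \<le> B"
proof -
  from gt_integrand_bound[of 0 N x] obtain C where "C > 0" and
    "\<forall>w \<nu> T. wall w \<longrightarrow> (\<forall>j\<in>{1..N}. \<bar>Re (\<nu> j)\<bar> \<le> 0) \<longrightarrow>
      cmod (gt_integrand N w \<nu> x T) \<le> C * exp (- (\<Sum>i\<in>free_entries N. \<bar>T i\<bar>))"
    by auto
  note C = this(2)[rule_format]
  let ?P = "Pi\<^sub>M (free_entries N) (\<lambda>_. lborel :: real measure)"
  define B where "B = (\<integral>T. C * exp (- (\<Sum>i\<in>free_entries N. \<bar>T i\<bar>)) \<partial>?P)"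
  have "B \<ge> 0" unfolding B_def using \<open>C > 0\<close> by (intro integral_nonneg_AE AE_I2) simp
  moreover have "cmod (gt_integral N w (\<lambda>j. - \<i> * of_real (k j)) x) \<le> B" if w: "wall w" for w k
    unfolding gt_integral_def B_def
  proof (rule order_trans[OF integral_norm_bound integral_mono])
    show "integrable ?P (\<lambda>T. cmod (gt_integrand N w (\<lambda>j. - \<i> * of_real (k j)) x T))"
      by (rule integrable_norm[OF integrable_gt_integrand[OF w]])
    show "integrable ?P (\<lambda>T. C * exp (- (\<Sum>i\<in>free_entries N. \<bar>T i\<bar>)))"
      by (rule integrable_exp_minus_sum) simp
    show "cmod (gt_integrand N w (\<lambda>j. - \<i> * of_real (k j)) x T) \<le> C * exp (- (\<Sum>i\<in>free_entries N. \<bar>T i\<bar>))" for T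
      by (rule C[OF w]) simp
  qed
  ultimately show ?thesis by (intro exI[of _ B]) auto
qed

lemma spectral_integral_tendsto:
  assumes t: "t > 0" and a: "\<And>n. 0 < a n" "\<And>n. a n < 1" "a \<longlonglongrightarrow> 0"
  shows "(\<lambda>n. \<integral>k. of_real (exp (- t * norm_sq N k / 2)) *
        gt_integral N (soft_wall (a n)) (\<lambda>j. - \<i> * of_real (k j)) x * of_real (sklyanin_ratio N (a n) k)
        \<partial>Pi\<^sub>M {1..N} (\<lambda>_. lborel)) \<longlonglongrightarrow>
      (\<integral>k. of_real (exp (- t * norm_sq N k / 2)) *
        gt_integral N hard_wall (\<lambda>j. - \<i> * of_real (k j)) x * of_real ((vdm N k)\<^sup>2)
        \<partial>Pi\<^sub>M {1..N} (\<lambda>_. lborel))"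
proof -
  obtain B where B: "B \<ge> 0" "\<And>w k. wall w \<Longrightarrow> cmod (gt_integral N w (\<lambda>j. - \<i> * of_real (k j)) x) \<le> B"
    using norm_gt_integral_imaginary_le[of N x] by (elim exE conjE) simp
  let ?M = "card (index_pairs N)"
  let ?P = "Pi\<^sub>M {1..N} (\<lambda>_. lborel :: real measure)"
  have soft: "wall (soft_wall (a n))" for n
    using a(1,2) by (intro wall_soft less_imp_le) auto
  have lim: "filterlim a (at_right 0) sequentially"
    using a by (intro tendsto_imp_filterlim_at_right) auto
  \<comment> \<open>With the wall and the scale as separate arguments, the limiting integrand is the
    instance \<open>F hard_wall 0\<close>, and measurability is shown for all of them
    together.\<close>
  define F where "F w b k = of_real (exp (- t * norm_sq N k / 2)) *
      gt_integral N w (\<lambda>j. - \<i> * of_real (k j)) x * of_real (sklyanin_ratio N b k)" for w b k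
  define W where "W k = B * 2 ^ ?M * (exp (- t * norm_sq N k / 2) * exp (10 * real ?M * (\<Sum>j=1..N. \<bar>k j\<bar>)))" for k
  have meas: "F w b \<in> borel_measurable ?P" if "wall w" for w b
  proof -
    note [measurable] = measurable_gt_integral[OF that] measurable_sklyanin_ratio
    show ?thesis unfolding F_def by measurable
  qed
  have "(\<lambda>n. \<integral>k. F (soft_wall (a n)) (a n) k \<partial>?P) \<longlonglongrightarrow> (\<integral>k. F hard_wall 0 k \<partial>?P)"
  proof (rule integral_dominated_convergence[where w = W])
    show "F hard_wall 0 \<in> borel_measurable ?P" by (rule meas[OF wall_hard])
    show "F (soft_wall (a n)) (a n) \<in> borel_measurable ?P" for n by (rule meas[OF soft])
    show "integrable ?P W"
      unfolding W_def by (intro integrable_mult_right integrable_gaussian_exp_sum t)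
    show "AE k in ?P. (\<lambda>n. F (soft_wall (a n)) (a n) k) \<longlonglongrightarrow> F hard_wall 0 k"
    proof (rule AE_I2)
      fix k
      have "(\<lambda>n. gt_integral N (soft_wall (a n)) (\<lambda>j. - \<i> * of_real (k j)) x) \<longlonglongrightarrow>
          gt_integral N hard_wall (\<lambda>j. - \<i> * of_real (k j)) x"
        by (rule gt_integral_tendsto[OF soft wall_hard filterlim_compose[OF soft_wall_tendsto lim]]) simp
      moreover have "(\<lambda>n. sklyanin_ratio N (a n) k) \<longlonglongrightarrow> sklyanin_ratio N 0 k"
        unfolding sklyanin_ratio_0 by (rule sklyanin_ratio_tendsto[OF a(3)])
      ultimately show "(\<lambda>n. F (soft_wall (a n)) (a n) k) \<longlonglongrightarrow> F hard_wall 0 k"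
        unfolding F_def by (intro tendsto_mult tendsto_const tendsto_of_real)
    qed
    show "AE k in ?P. norm (F (soft_wall (a n)) (a n) k) \<le> W k" for n
    proof (rule AE_I2)
      fix k
      let ?e = "exp (- t * norm_sq N k / 2)"
      have "norm (F (soft_wall (a n)) (a n) k) =
          ?e * (cmod (gt_integral N (soft_wall (a n)) (\<lambda>j. - \<i> * of_real (k j)) x) * sklyanin_ratio N (a n) k)"
        unfolding F_def
        by (simp only: norm_mult norm_of_real abs_exp_cancel abs_of_nonneg[OF sklyanin_ratio_nonneg] mult.assoc)
      also have "\<dots> \<le> ?e * (B * (2 ^ ?M * exp (10 * real ?M * (\<Sum>j=1..N. \<bar>k j\<bar>))))"
      proof (intro mult_left_mono mult_mono)
        show "sklyanin_ratio N (a n) k \<le> 2 ^ ?M * exp (10 * real ?M * (\<Sum>j=1..N. \<bar>k j\<bar>))"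
          using sklyanin_ratio_bound[of "a n" N k] a(1,2)[of n] by simp
      qed (use B soft sklyanin_ratio_nonneg in auto)
      finally show "norm (F (soft_wall (a n)) (a n) k) \<le> W k"
        unfolding W_def by (simp only: mult_ac)
    qed
  qed
  then show ?thesis
    unfolding F_def sklyanin_ratio_0 .
qed

section \<open>Small patterns\<close>

definition gt_real :: "nat \<Rightarrow> (nat \<Rightarrow> real) \<Rightarrow> (nat \<Rightarrow> real) \<Rightarrow> real" where
  "gt_real N \<nu> x = Re (gt_integral N hard_wall (\<lambda>j. of_real (\<nu> j)) x)"

lemma gt_linear_of_real:
  "gt_linear N (\<lambda>j. of_real (\<nu> j)) T = of_real (Re (gt_linear N (\<lambda>j. of_real (\<nu> j)) T))"
  unfolding gt_linear_def by (simp flip: of_real_mult of_real_sum of_real_diff)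

lemma gt_integrand_of_real:
  "gt_integrand N w (\<lambda>j. of_real (\<nu> j)) x T = complex_of_real
    (exp (Re (gt_linear N (\<lambda>j. of_real (\<nu> j)) (with_last_row N x T))) * gt_weight N w (with_last_row N x T))"
  unfolding gt_integrand_def by (subst gt_linear_of_real) (simp add: exp_of_real)

lemma gt_real:
  "gt_integral N hard_wall (\<lambda>j. of_real (\<nu> j)) x = complex_of_real (gt_real N \<nu> x)"
  unfolding gt_real_def gt_integral_def gt_integrand_of_real integral_complex_of_real by simp

lemma gt_real_tendsto:
  assumes "\<And>j. j \<in> {1..N} \<Longrightarrow> (\<lambda>n. \<nu> n j) \<longlonglongrightarrow> \<nu>' j"
  shows "(\<lambda>n. gt_real N (\<nu> n) x) \<longlonglongrightarrow> gt_real N \<nu>' x"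
  unfolding gt_real_def
  by (intro tendsto_Re gt_integral_tendsto wall_hard tendsto_const tendsto_of_real assms)

lemma det_mat_eq_idet: "det_mat N A = idet N A"
  by (simp add: det_mat_def idet_def)

lemma vandermonde_eq_vdm: "vandermonde N x = vdm N x"
  by (simp add: vandermonde_def vdm_def)

lemma vdm_gt_real:
  assumes "mono_on {1..N} x"
  shows "vdm N \<nu> * gt_real N \<nu> x = idet N (\<lambda>j k. exp (\<nu> j * x k))"
proof -
  have "complex_of_real (vdm N \<nu> * gt_real N \<nu> x) = of_real (det_mat N (\<lambda>j k. exp (\<nu> j * x k)))"
    using vdm_gt_integral[OF assms, of "\<lambda>j. of_real (\<nu> j)"]
    by (simp only: vdm_of_real gt_real of_real_det_mat exp_of_real[symmetric] of_real_mult)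
  then show ?thesis
    unfolding det_mat_eq_idet by (simp only: of_real_eq_iff)
qed

lemma vdm_pos:
  assumes "strict_mono_on {1..N} (x :: nat \<Rightarrow> real)"
  shows "vdm N x > 0"
  unfolding vdm_def using assms
  by (intro prod_pos) (auto simp: index_pairs_def strict_mono_on_def)

lemma hard_wall_neq_0_iff: "hard_wall u \<noteq> 0 \<longleftrightarrow> u \<ge> 0"
  by (simp add: hard_wall_def)

text \<open>On the support every entry lies between two entries of the next longer row; descending
  from row \<open>N\<close>, no entry can exceed the bound on that row.\<close>

lemma gt_weight_hard_support:
  assumes "gt_weight N hard_wall T \<noteq> 0" and r: "\<And>k. k \<in> {1..N} \<Longrightarrow> \<bar>T (N, k)\<bar> \<le> r"
    and "j \<in> {1..N}" "k \<in> {1..j}"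
  shows "\<bar>T (j, k)\<bar> \<le> r"
proof -
  have interlace: "T (i + 1, l) \<le> T (i, l) \<and> T (i, l) \<le> T (i + 1, l + 1)" if "i \<in> {1..N-1}" "l \<in> {1..i}" for i l
  proof -
    have "hard_wall (T (i, l) - T (i + 1, l)) * hard_wall (T (i + 1, l + 1) - T (i, l)) \<noteq> 0"
      using assms(1) that unfolding gt_weight_def
      by (meson finite_atLeastAtMost prod_zero)
    then show ?thesis by (simp add: hard_wall_neq_0_iff)
  qed
  have "j \<le> N" using assms by simp
  then have "\<forall>k\<in>{1..j}. \<bar>T (j, k)\<bar> \<le> r" using \<open>j \<in> {1..N}\<close>
  proof (induction rule: inc_induct)
    case base
    then show ?case using r by simp
  next
    case (step i)
    show ?case
    proof
      fix k assume k: "k \<in> {1..i}"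
      have "i \<in> {1..N-1}" using step by auto
      from interlace[OF this k]
      have "T (Suc i, k) \<le> T (i, k)" "T (i, k) \<le> T (Suc i, Suc k)" by simp_all
      moreover have "\<bar>T (Suc i, k)\<bar> \<le> r" "\<bar>T (Suc i, Suc k)\<bar> \<le> r"
        using step k by auto
      ultimately show "\<bar>T (i, k)\<bar> \<le> r" by linarith
    qed
  qed
  then show ?thesis using \<open>k \<in> {1..j}\<close> by (rule bspec)
qed

text \<open>Each row sum is at most \<open>N * r\<close> in modulus, two of them enter each
  difference, and there are \<open>N\<close> differences.\<close>

lemma gt_linear_small:
  assumes T: "\<And>j k. j \<in> {1..N} \<Longrightarrow> k \<in> {1..j} \<Longrightarrow> \<bar>T (j, k)\<bar> \<le> r"
    and \<nu>: "\<And>j. j \<in> {1..N} \<Longrightarrow> \<bar>\<nu> j\<bar> \<le> L" and "0 \<le> r" "0 \<le> L"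
  shows "\<bar>Re (gt_linear N (\<lambda>j. of_real (\<nu> j)) T)\<bar> \<le> 2 * real N * real N * L * r"
proof -
  have row: "\<bar>\<Sum>k=1..j. T (j, k)\<bar> \<le> real N * r" if "j \<le> N" for j
  proof -
    have "\<bar>\<Sum>k=1..j. T (j, k)\<bar> \<le> (\<Sum>k=1..j. \<bar>T (j, k)\<bar>)" by (rule sum_abs)
    also have "\<dots> \<le> (\<Sum>k=1..j. r)" using that T by (intro sum_mono) auto
    also have "\<dots> \<le> real N * r" using that \<open>0 \<le> r\<close> by (simp add: mult_right_mono)
    finally show ?thesis .
  qed
  have "\<bar>\<nu> j * ((\<Sum>k=1..j. T (j, k)) - (\<Sum>k=1..j-1. T (j - 1, k)))\<bar> \<le> L * (2 * real N * r)"
    if "j \<in> {1..N}" for j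
    unfolding abs_mult
  proof (rule mult_mono)
    have "j \<le> N" "j - 1 \<le> N" using that by auto
    from row[OF this(1)] row[OF this(2)]
    show "\<bar>(\<Sum>k=1..j. T (j, k)) - (\<Sum>k=1..j-1. T (j - 1, k))\<bar> \<le> 2 * real N * r" by linarith
  qed (use \<nu>[OF that] \<open>0 \<le> L\<close> in auto)
  then have "(\<Sum>j=1..N. \<bar>\<nu> j * ((\<Sum>k=1..j. T (j, k)) - (\<Sum>k=1..j-1. T (j - 1, k)))\<bar>) \<le> (\<Sum>j=1..N. L * (2 * real N * r))"
    by (rule sum_mono)
  moreover have "\<bar>Re (gt_linear N (\<lambda>j. of_real (\<nu> j)) T)\<bar> \<le>
      (\<Sum>j=1..N. \<bar>\<nu> j * ((\<Sum>k=1..j. T (j, k)) - (\<Sum>k=1..j-1. T (j - 1, k)))\<bar>)"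
    unfolding gt_linear_def Re_sum by (rule order_trans[OF sum_abs]) (simp add: sum_mono)
  ultimately show ?thesis by (simp add: algebra_simps)
qed

text \<open>On the support of the weight the exponential differs from \<open>1\<close> by a factor
  between \<open>exp (- (2 * N * N * L * r))\<close> and its inverse; off the support both
  integrands vanish. At parameter \<open>0\<close> the integral is the volume of the
  patterns.\<close>

lemma gt_real_bounds:
  assumes x: "\<And>k. k \<in> {1..N} \<Longrightarrow> \<bar>x k\<bar> \<le> r"
    and \<nu>: "\<And>j. j \<in> {1..N} \<Longrightarrow> \<bar>\<nu> j\<bar> \<le> L" and "0 \<le> r" "0 \<le> L"
  shows "exp (- (2 * real N * real N * L * r)) * gt_real N (\<lambda>_. 0) x \<le> gt_real N \<nu> x"
    and "gt_real N \<nu> x \<le> exp (2 * real N * real N * L * r) * gt_real N (\<lambda>_. 0) x"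
    and "0 \<le> gt_real N \<nu> x"
proof -
  let ?P = "Pi\<^sub>M (free_entries N) (\<lambda>_. lborel :: real measure)"
  let ?e = "2 * real N * real N * L * r"
  let ?W = "\<lambda>T. gt_weight N hard_wall (with_last_row N x T)"
  let ?g = "\<lambda>\<nu> T. exp (Re (gt_linear N (\<lambda>j. of_real (\<nu> j)) (with_last_row N x T))) * ?W T"
  have int: "integrable ?P (?g \<nu>)" for \<nu>
    using integrable_bounded_linear[OF bounded_linear_Re
        integrable_gt_integrand[OF wall_hard, of N "\<lambda>j. of_real (\<nu> j)" x]]
    unfolding gt_integrand_of_real by (simp only: Re_complex_of_real)
  have eq: "gt_real N \<nu> x = (\<integral>T. ?g \<nu> T \<partial>?P)" for \<nu>
    unfolding gt_real_def gt_integral_def gt_integrand_of_real integral_complex_of_real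
    by (rule Re_complex_of_real)
  have W0: "0 \<le> ?W T" for T
    unfolding gt_weight_def by (intro prod_nonneg ballI mult_nonneg_nonneg) (auto simp: hard_wall_def)
  have zero: "?g (\<lambda>_. 0) T = ?W T" for T
    by (simp add: gt_linear_def)
  have lin: "\<bar>Re (gt_linear N (\<lambda>j. of_real (\<nu> j)) (with_last_row N x T))\<bar> \<le> ?e" if "?W T \<noteq> 0" for T
  proof (rule gt_linear_small[OF _ \<nu> assms(3,4)])
    fix j k assume "j \<in> {1..N}" "k \<in> {1..j}"
    then show "\<bar>with_last_row N x T (j, k)\<bar> \<le> r"
      by (rule gt_weight_hard_support[OF that, rotated]) (simp add: with_last_row_def x)
  qed
  have le1: "exp (- ?e) * ?g (\<lambda>_. 0) T \<le> ?g \<nu> T" for T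
  proof (cases "?W T = 0")
    case False
    from lin[OF this] have "- ?e \<le> Re (gt_linear N (\<lambda>j. of_real (\<nu> j)) (with_last_row N x T))" by linarith
    then show ?thesis unfolding zero by (intro mult_right_mono W0) simp
  qed (simp only: mult_zero_right order_refl)
  have le2: "?g \<nu> T \<le> exp ?e * ?g (\<lambda>_. 0) T" for T
  proof (cases "?W T = 0")
    case False
    from lin[OF this] have "Re (gt_linear N (\<lambda>j. of_real (\<nu> j)) (with_last_row N x T)) \<le> ?e" by linarith
    then show ?thesis unfolding zero by (intro mult_right_mono W0) simp
  qed (simp only: mult_zero_right order_refl)
  have "(\<integral>T. exp (- ?e) * ?g (\<lambda>_. 0) T \<partial>?P) \<le> (\<integral>T. ?g \<nu> T \<partial>?P)"
    by (rule integral_mono[OF integrable_mult_right[OF int] int le1])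
  then show "exp (- ?e) * gt_real N (\<lambda>_. 0) x \<le> gt_real N \<nu> x"
    unfolding eq integral_mult_right_zero .
  have "(\<integral>T. ?g \<nu> T \<partial>?P) \<le> (\<integral>T. exp ?e * ?g (\<lambda>_. 0) T \<partial>?P)"
    by (rule integral_mono[OF int integrable_mult_right[OF int] le2])
  then show "gt_real N \<nu> x \<le> exp ?e * gt_real N (\<lambda>_. 0) x"
    unfolding eq integral_mult_right_zero .
  have "0 \<le> ?g \<nu> T" for T by (intro mult_nonneg_nonneg W0) simp
  then show "0 \<le> gt_real N \<nu> x"
    unfolding eq by (rule Bochner_Integration.integral_nonneg)
qed

text \<open>A vanishing volume would force \<open>det (exp (j * x k))\<close> to vanish, which is a Vandermonde
  determinant in \<open>exp (x k)\<close> up to a factor.\<close>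

lemma gt_volume_pos:
  assumes x: "strict_mono_on {1..N} x"
  shows "gt_real N (\<lambda>_. 0) x > 0"
proof -
  define r where "r = (\<Sum>k=1..N. \<bar>x k\<bar>)"
  have r: "\<bar>x k\<bar> \<le> r" if "k \<in> {1..N}" for k
    unfolding r_def using that by (intro member_le_sum) auto
  have r0: "0 \<le> r" by (simp add: r_def sum_nonneg)
  have L: "\<bar>real j\<bar> \<le> real N" if "j \<in> {1..N}" for j using that by simp
  note b = gt_real_bounds[of N x r "\<lambda>j. real j" "real N", OF r L r0]
  have "idet N (\<lambda>j k. exp (real j * x k)) = idet N (\<lambda>j k. 1 * exp (x k) * exp (x k) ^ (j - 1))"
  proof (rule idet_cong)
    fix j k assume "j \<in> {1..N}"
    then obtain i where "j = Suc i" by (cases j) auto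
    then show "exp (real j * x k) = 1 * exp (x k) * exp (x k) ^ (j - 1)"
      by (simp add: exp_of_nat_mult[symmetric] exp_add[symmetric] algebra_simps)
  qed
  also have "\<dots> = (\<Prod>k=1..N. exp (x k)) * vdm N (\<lambda>k. exp (x k))"
    unfolding idet_scale idet_powers by simp
  also have "\<dots> > 0"
    using x by (intro mult_pos_pos prod_pos vdm_pos) (auto simp: strict_mono_on_def)
  finally have "vdm N (\<lambda>j. real j) * gt_real N (\<lambda>j. real j) x > 0"
    using vdm_gt_real[of N x "\<lambda>j. real j"] strict_mono_on_imp_mono_on[OF x] by simp
  then have "gt_real N (\<lambda>j. real j) x \<noteq> 0" by auto
  then have "gt_real N (\<lambda>j. real j) x > 0" using b(3) by simp
  also note b(2)
  finally show ?thesis by (simp add: zero_less_mult_iff)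
qed

text \<open>The size \<open>r\<close> of the top row tends to \<open>0\<close> while the size
  \<open>L\<close> of the parameters stays bounded, so the exponents in
  \<open>gt_real_bounds\<close> tend to \<open>0\<close> and squeeze the ratio, however small the
  volume becomes.\<close>

lemma gt_real_ratio_tendsto:
  assumes x: "\<And>n. strict_mono_on {1..N} (x n)" "\<And>k. k \<in> {1..N} \<Longrightarrow> (\<lambda>n. x n k) \<longlonglongrightarrow> 0"
    and \<nu>: "\<And>j. j \<in> {1..N} \<Longrightarrow> (\<lambda>n. \<nu> n j) \<longlonglongrightarrow> \<nu>' j"
  shows "(\<lambda>n. gt_real N (\<nu> n) (x n) / gt_real N (\<lambda>_. 0) (x n)) \<longlonglongrightarrow> 1"
proof -
  define r where "r n = (\<Sum>k=1..N. \<bar>x n k\<bar>)" for n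
  define L where "L n = (\<Sum>j=1..N. \<bar>\<nu> n j\<bar>)" for n
  define e where "e n = 2 * real N * real N * L n * r n" for n
  have "r \<longlonglongrightarrow> 0"
    unfolding r_def by (intro tendsto_null_sum tendsto_rabs_zero x)
  moreover have "L \<longlonglongrightarrow> (\<Sum>j=1..N. \<bar>\<nu>' j\<bar>)"
    unfolding L_def by (intro tendsto_sum tendsto_rabs \<nu>)
  ultimately have "e \<longlonglongrightarrow> 2 * real N * real N * (\<Sum>j=1..N. \<bar>\<nu>' j\<bar>) * 0"
    unfolding e_def by (intro tendsto_mult tendsto_const)
  then have e: "e \<longlonglongrightarrow> 0" by (simp only: mult_zero_right)
  have b: "exp (- e n) \<le> gt_real N (\<nu> n) (x n) / gt_real N (\<lambda>_. 0) (x n)"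
    "gt_real N (\<nu> n) (x n) / gt_real N (\<lambda>_. 0) (x n) \<le> exp (e n)" for n
  proof -
    have r: "\<bar>x n k\<bar> \<le> r n" if "k \<in> {1..N}" for k
      unfolding r_def using that by (intro member_le_sum) auto
    have L: "\<bar>\<nu> n j\<bar> \<le> L n" if "j \<in> {1..N}" for j
      unfolding L_def using that by (intro member_le_sum) auto
    have "0 \<le> r n" "0 \<le> L n" by (simp_all add: r_def L_def sum_nonneg)
    from gt_real_bounds[of N "x n" "r n" "\<nu> n" "L n", OF r L this] gt_volume_pos[OF x(1)[of n]]
    show "exp (- e n) \<le> gt_real N (\<nu> n) (x n) / gt_real N (\<lambda>_. 0) (x n)"
      "gt_real N (\<nu> n) (x n) / gt_real N (\<lambda>_. 0) (x n) \<le> exp (e n)"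
      unfolding e_def by (simp_all only: pos_le_divide_eq pos_divide_le_eq)
  qed
  have lo: "(\<lambda>n. exp (- e n)) \<longlonglongrightarrow> 1" and hi: "(\<lambda>n. exp (e n)) \<longlonglongrightarrow> 1"
    using tendsto_exp[OF tendsto_minus[OF e]] tendsto_exp[OF e] by simp_all
  show ?thesis
    by (rule tendsto_sandwich[OF always_eventually always_eventually lo hi]) (intro allI b)+
qed

section \<open>The limit\<close>

text \<open>The meeting point of the proof: the O'Connell density tends to this value, and both
  noncolliding densities equal it.\<close>

definition limit_density :: "nat \<Rightarrow> real \<Rightarrow> (nat \<Rightarrow> real) \<Rightarrow> (nat \<Rightarrow> real) \<Rightarrow> real" where
  "limit_density N t x \<nu> = exp (- t * norm_sq N \<nu> / 2) * gt_real N \<nu> x *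
     (\<Prod>j=1..N. exp (- (x j)\<^sup>2 / (2 * t)) / sqrt (2 * pi * t)) * (vdm N x / t ^ card (index_pairs N))"

text \<open>Each of the two Whittaker functions contributes one factor \<open>c\<close> and the
  Sklyanin density contributes \<open>d\<^sup>2\<close>; as \<open>c * d = 1\<close>, the powers of
  \<open>a\<close> cancel exactly for every \<open>a > 0\<close>.\<close>

lemma oconnell_density_scale:
  assumes a: "a > 0"
  shows "oconnell_density N (\<lambda>j. a * \<nu> j) a t x =
    of_real (exp (- t * norm_sq N \<nu> / 2)) * gt_integral N (soft_wall a) (\<lambda>j. of_real (\<nu> j)) x *
    (of_real (1 / ((2 * pi) ^ N * fact N)) *
     (\<integral>k. of_real (exp (- t * norm_sq N k / 2)) *
        gt_integral N (soft_wall a) (\<lambda>j. - \<i> * of_real (k j)) x * of_real (sklyanin_ratio N a k)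
        \<partial>Pi\<^sub>M {1..N} (\<lambda>_. lborel)))"
proof -
  define c where "c = complex_of_real ((1 / a) ^ card (index_pairs N))"
  define d where "d = complex_of_real (a ^ card (index_pairs N))"
  define q where "q = complex_of_real (1 / ((2 * pi) ^ N * fact N))"
  have cd: "c * d = 1"
    using a unfolding c_def d_def of_real_mult[symmetric] power_mult_distrib[symmetric] by simp
  have "norm_sq N (\<lambda>j. a * \<nu> j) = a\<^sup>2 * norm_sq N \<nu>"
    by (simp add: norm_sq_def power_mult_distrib sum_distrib_left)
  then have e: "exp (- t * norm_sq N (\<lambda>j. a * \<nu> j) / (2 * a\<^sup>2)) = exp (- t * norm_sq N \<nu> / 2)"
    using a by simp
  have w1: "whittaker N (\<lambda>j. of_real (a * \<nu> j)) (\<lambda>j. x j / a) =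
      c * gt_integral N (soft_wall a) (\<lambda>j. of_real (\<nu> j)) x"
    unfolding c_def of_real_mult by (rule whittaker_scale[OF a])
  have w2: "whittaker N (\<lambda>j. - \<i> * of_real (a * k j)) (\<lambda>j. x j / a) =
      c * gt_integral N (soft_wall a) (\<lambda>j. - \<i> * of_real (k j)) x" for k
  proof -
    have "(\<lambda>j. - \<i> * complex_of_real (a * k j)) = (\<lambda>j. of_real a * (- \<i> * of_real (k j)))"
      by auto
    then show ?thesis
      unfolding c_def by (simp only: whittaker_scale[OF a])
  qed
  have s: "complex_of_real (sklyanin N (\<lambda>j. a * k j)) = q * (d * d) * of_real (sklyanin_ratio N a k)" for k
    unfolding sklyanin_scale q_def d_def of_real_mult power2_eq_square ..
  let ?I = "\<lambda>k. of_real (exp (- t * norm_sq N k / 2)) *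
        gt_integral N (soft_wall a) (\<lambda>j. - \<i> * of_real (k j)) x * of_real (sklyanin_ratio N a k)"
  have i: "of_real (exp (- t * norm_sq N k / 2)) * whittaker N (\<lambda>j. - \<i> * of_real (a * k j)) (\<lambda>j. x j / a) *
      of_real (sklyanin N (\<lambda>j. a * k j)) = (c * d) * (d * q) * ?I k" for k
    unfolding w2 s by (simp only: mult_ac)
  have "oconnell_density N (\<lambda>j. a * \<nu> j) a t x = of_real (exp (- t * norm_sq N \<nu> / 2)) *
      (c * gt_integral N (soft_wall a) (\<lambda>j. of_real (\<nu> j)) x) *
      ((c * d) * (d * q) * (\<integral>k. ?I k \<partial>Pi\<^sub>M {1..N} (\<lambda>_. lborel)))"
    unfolding oconnell_density_def e w1 i integral_mult_right_zero ..
  also have "\<dots> = (c * d) * (c * d) * (of_real (exp (- t * norm_sq N \<nu> / 2)) *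
      gt_integral N (soft_wall a) (\<lambda>j. of_real (\<nu> j)) x * (q * (\<integral>k. ?I k \<partial>Pi\<^sub>M {1..N} (\<lambda>_. lborel))))"
    by (simp only: mult_ac)
  finally show ?thesis unfolding cd q_def by (simp only: mult_1)
qed

text \<open>Per coordinate this is
  \<open>sqrt (2 * pi / t) / (2 * pi) = 1 / sqrt (2 * pi * t)\<close>, and the factorial from
  Andreief's identity meets that of the Sklyanin density.\<close>

lemma gaussian_normalization:
  assumes t: "t > 0"
  shows "1 / ((2 * pi) ^ N * fact N) * (fact N * (\<Prod>j=1..N. sqrt (2 * pi / t) * exp (- (x j)\<^sup>2 / (2 * t)))) =
    (\<Prod>j=1..N. exp (- (x j)\<^sup>2 / (2 * t)) / sqrt (2 * pi * t))"
proof -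
  have *: "sqrt (2 * pi / t) / (2 * pi) = 1 / sqrt (2 * pi * t)"
  proof -
    have "sqrt (2 * pi / t) * sqrt (2 * pi * t) = 2 * pi"
    proof -
      have "sqrt (2 * pi / t) * sqrt (2 * pi * t) = sqrt ((2 * pi)\<^sup>2)"
        unfolding real_sqrt_mult[symmetric] using t by (simp add: power2_eq_square)
      also have "\<dots> = 2 * pi" unfolding real_sqrt_abs by simp
      finally show ?thesis .
    qed
    then show ?thesis using t by (simp add: field_simps)
  qed
  have "(\<Prod>j=1..N. exp (- (x j)\<^sup>2 / (2 * t)) / sqrt (2 * pi * t)) =
      (\<Prod>j=1..N. (1 / (2 * pi)) * (sqrt (2 * pi / t) * exp (- (x j)\<^sup>2 / (2 * t))))"
  proof (rule prod.cong[OF refl])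
    fix j
    have "exp (- (x j)\<^sup>2 / (2 * t)) / sqrt (2 * pi * t) = exp (- (x j)\<^sup>2 / (2 * t)) * (1 / sqrt (2 * pi * t))" by simp
    also have "\<dots> = (1 / (2 * pi)) * (sqrt (2 * pi / t) * exp (- (x j)\<^sup>2 / (2 * t)))"
      unfolding *[symmetric] by simp
    finally show "exp (- (x j)\<^sup>2 / (2 * t)) / sqrt (2 * pi * t) =
      (1 / (2 * pi)) * (sqrt (2 * pi / t) * exp (- (x j)\<^sup>2 / (2 * t)))" .
  qed
  also have "\<dots> = (1 / (2 * pi)) ^ N * (\<Prod>j=1..N. sqrt (2 * pi / t) * exp (- (x j)\<^sup>2 / (2 * t)))"
    unfolding prod.distrib prod_constant by simp
  finally show ?thesis by (simp add: power_divide)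
qed

lemma oconnell_density_tendsto:
  assumes t: "t > 0" and x: "mono_on {1..N} x"
  shows "((\<lambda>a. oconnell_density N (\<lambda>j. a * \<nu> j) a t x) \<longlongrightarrow> of_real (limit_density N t x \<nu>)) (at_right 0)"
proof (rule tendsto_at_right_sequentially[of 0 1])
  \<comment> \<open>Sequences in the interval from \<open>0\<close> to \<open>1\<close> suffice:
    dominated convergence is applied along sequences, and \<open>wall_soft\<close> asks for
    \<open>a \<le> 1\<close>.\<close>
  fix a :: "nat \<Rightarrow> real" assume a: "\<And>n. 0 < a n" "\<And>n. a n < 1" "a \<longlonglongrightarrow> 0"
  let ?q = "complex_of_real (1 / ((2 * pi) ^ N * fact N))"
  let ?J = "\<integral>k. of_real (exp (- t * norm_sq N k / 2)) * gt_integral N hard_wall (\<lambda>j. - \<i> * of_real (k j)) x *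
      of_real ((vdm N k)\<^sup>2) \<partial>Pi\<^sub>M {1..N} (\<lambda>_. lborel)"
  have soft: "wall (soft_wall (a n))" for n
    using a by (intro wall_soft less_imp_le) auto
  have lim: "filterlim a (at_right 0) sequentially"
    using a by (intro tendsto_imp_filterlim_at_right) auto
  have "(\<lambda>n. gt_integral N (soft_wall (a n)) (\<lambda>j. of_real (\<nu> j)) x) \<longlonglongrightarrow>
      gt_integral N hard_wall (\<lambda>j. of_real (\<nu> j)) x"
    by (rule gt_integral_tendsto[OF soft wall_hard filterlim_compose[OF soft_wall_tendsto lim]]) simp
  then have "(\<lambda>n. oconnell_density N (\<lambda>j. a n * \<nu> j) (a n) t x) \<longlonglongrightarrow>
      of_real (exp (- t * norm_sq N \<nu> / 2)) * gt_integral N hard_wall (\<lambda>j. of_real (\<nu> j)) x * (?q * ?J)"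
    unfolding oconnell_density_scale[OF a(1)]
    by (intro tendsto_mult tendsto_const spectral_integral_tendsto t a)
  also have "?q * ?J = of_real ((1 / ((2 * pi) ^ N * fact N) * (fact N * (\<Prod>j=1..N. sqrt (2 * pi / t) * exp (- (x j)\<^sup>2 / (2 * t))))) *
      (vdm N x / t ^ card (index_pairs N)))"
    unfolding integral_gt_integral_gaussian[OF t x] by simp
  finally show "(\<lambda>n. oconnell_density N (\<lambda>j. a n * \<nu> j) (a n) t x) \<longlonglongrightarrow> of_real (limit_density N t x \<nu>)"
    unfolding gaussian_normalization[OF t] gt_real limit_density_def by (simp only: of_real_mult mult.assoc)
qed simp

section \<open>Identification with the densities of noncolliding Brownian motion\<close>

lemma limit_density_tendsto:
  assumes "\<And>j. j \<in> {1..N} \<Longrightarrow> (\<lambda>n. \<nu> n j) \<longlonglongrightarrow> \<nu>' j"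
  shows "(\<lambda>n. limit_density N t x (\<nu> n)) \<longlonglongrightarrow> limit_density N t x \<nu>'"
  unfolding limit_density_def norm_sq_def
  by (intro tendsto_mult tendsto_const gt_real_tendsto tendsto_exp tendsto_divide tendsto_sum tendsto_power assms) auto

text \<open>Expanding the square in the heat kernel leaves one factor per row, one per column, and a
  determinant of exponentials of the cross terms.\<close>

lemma karlin_mcgregor_eq:
  assumes t: "t > 0"
  shows "karlin_mcgregor N t y x = (\<Prod>j=1..N. exp (- (y j)\<^sup>2 / (2 * t)) / sqrt (2 * pi * t)) *
    exp (- norm_sq N x / (2 * t)) * idet N (\<lambda>j k. exp (y j / t * x k))"
proof -
  have "karlin_mcgregor N t y x = idet N (\<lambda>j k. (exp (- (y j)\<^sup>2 / (2 * t)) / sqrt (2 * pi * t)) *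
      exp (- (x k)\<^sup>2 / (2 * t)) * exp (y j / t * x k))"
    unfolding karlin_mcgregor_def det_mat_eq_idet
  proof (rule idet_cong)
    fix j k
    have "- (x k - y j)\<^sup>2 / (2 * t) = - (y j)\<^sup>2 / (2 * t) + - (x k)\<^sup>2 / (2 * t) + y j / t * x k"
      using t by (simp add: power2_eq_square field_simps)
    then show "heat_kernel t (y j) (x k) = (exp (- (y j)\<^sup>2 / (2 * t)) / sqrt (2 * pi * t)) *
        exp (- (x k)\<^sup>2 / (2 * t)) * exp (y j / t * x k)"
      unfolding heat_kernel_def by (simp only: exp_add) simp
  qed
  also have "(\<Prod>k=1..N. exp (- (x k)\<^sup>2 / (2 * t))) = exp (- norm_sq N x / (2 * t))"
    by (simp only: exp_sum[symmetric] finite_atLeastAtMost norm_sq_def sum_divide_distrib sum_negf[symmetric])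
  ultimately show ?thesis
    unfolding idet_scale by simp
qed

text \<open>Time inversion: at time \<open>1 / t\<close> and end point \<open>x / t\<close> the
  cross term is \<open>x j * \<nu> k\<close>, the one in the determinant formula with top row
  \<open>x\<close> and parameters \<open>\<nu>\<close>. Its factor \<open>vdm N \<nu>\<close>
  cancels the denominator.\<close>

lemma noncolliding_density_chamber:
  assumes t: "t > 0" and x: "mono_on {1..N} x" and \<nu>: "\<nu> \<in> weyl_chamber N"
  shows "1 / t ^ N * (vandermonde N (\<lambda>j. x j / t) / vandermonde N \<nu> * karlin_mcgregor N (1 / t) (\<lambda>j. x j / t) \<nu>) =
    limit_density N t x \<nu>"
proof -
  let ?M = "card (index_pairs N)"
  have \<nu>0: "vdm N \<nu> \<noteq> 0"
    using vdm_pos[of N \<nu>] \<nu> by (simp add: weyl_chamber_def)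
  have "idet N (\<lambda>j k. exp (x j / t / (1 / t) * \<nu> k)) = idet N (\<lambda>j k. exp (\<nu> j * x k))"
    using t by (subst idet_transpose[symmetric]) (simp add: mult.commute)
  also have "\<dots> = vdm N \<nu> * gt_real N \<nu> x"
    by (rule vdm_gt_real[OF x, symmetric])
  finally have K: "karlin_mcgregor N (1 / t) (\<lambda>j. x j / t) \<nu> =
      (\<Prod>j=1..N. exp (- (x j / t)\<^sup>2 / (2 * (1 / t))) / sqrt (2 * pi * (1 / t))) *
      exp (- norm_sq N \<nu> / (2 * (1 / t))) * (vdm N \<nu> * gt_real N \<nu> x)"
    using karlin_mcgregor_eq[of "1 / t" N "\<lambda>j. x j / t" \<nu>] t by simp
  have V: "vandermonde N (\<lambda>j. x j / t) = vdm N x / t ^ ?M"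
    using vdm_scale[of N "1 / t" x] by (simp add: vandermonde_eq_vdm power_divide)
  \<comment> \<open>The Jacobian, \<open>1 / t\<close> per coordinate, converts the Gaussian
    normalization for time \<open>1 / t\<close> into the one for time \<open>t\<close>.\<close>
  have "exp (- (x j)\<^sup>2 / (2 * t)) / sqrt (2 * pi * t) =
      1 / t * (exp (- (x j / t)\<^sup>2 / (2 * (1 / t))) / sqrt (2 * pi * (1 / t)))" for j
  proof -
    have "t * sqrt (2 * pi * (1 / t)) = sqrt (t\<^sup>2) * sqrt (2 * pi * (1 / t))" using t by simp
    also have "\<dots> = sqrt (2 * pi * t)"
      using t unfolding real_sqrt_mult[symmetric] by (simp add: power2_eq_square)
    finally have "sqrt (2 * pi * t) = t * sqrt (2 * pi * (1 / t))" ..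
    moreover have "- (x j / t)\<^sup>2 / (2 * (1 / t)) = - (x j)\<^sup>2 / (2 * t)"
      using t by (simp add: power2_eq_square field_simps)
    ultimately show ?thesis by simp
  qed
  then have P: "(\<Prod>j=1..N. exp (- (x j)\<^sup>2 / (2 * t)) / sqrt (2 * pi * t)) =
      1 / t ^ N * (\<Prod>j=1..N. exp (- (x j / t)\<^sup>2 / (2 * (1 / t))) / sqrt (2 * pi * (1 / t)))"
    by (simp only: prod.distrib prod_constant) (simp add: power_divide)
  have E: "exp (- norm_sq N \<nu> / (2 * (1 / t))) = exp (- t * norm_sq N \<nu> / 2)"
    using t by (simp add: mult.commute)
  show ?thesis
    unfolding K V unfolding limit_density_def P E vandermonde_eq_vdm using \<nu>0 by simp
qed

lemma tendsto_coordinate: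
  fixes X :: "nat \<Rightarrow> nat \<Rightarrow> real"
  assumes "X \<longlonglongrightarrow> \<nu>"
  shows "(\<lambda>n. X n j) \<longlonglongrightarrow> \<nu> j"
  by (rule continuous_on_tendsto_compose[OF continuous_on_product_coordinates assms]) auto

text \<open>A strictly increasing perturbation reaches boundary points from inside the chamber; it
  shows that the filters of the continuous extensions are nontrivial.\<close>

lemma weyl_chamber_perturb:
  assumes "\<nu> \<in> closed_weyl_chamber N" "e > 0"
  shows "(\<lambda>j. \<nu> j + e * real j) \<in> weyl_chamber N"
  using assms by (auto simp: weyl_chamber_def closed_weyl_chamber_def strict_mono_on_def mono_on_def
      intro!: add_le_less_mono)

lemma perturb_tendsto: "(\<lambda>n. \<lambda>j. \<nu> j + inverse (real (Suc n)) * real j) \<longlonglongrightarrow> \<nu>"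
proof -
  let ?g = "\<lambda>e j. \<nu> j + e * real j"
  have "continuous_on UNIV ?g"
    by (intro continuous_on_coordinatewise_then_product continuous_intros)
  then have "(\<lambda>n. ?g (inverse (real (Suc n)))) \<longlonglongrightarrow> ?g 0"
    by (rule continuous_on_tendsto_compose[OF _ LIMSEQ_inverse_real_of_nat]) auto
  then show ?thesis by simp
qed

lemma noncolliding_density_eq:
  assumes t: "t > 0" and x: "mono_on {1..N} x" and \<nu>: "\<nu> \<in> closed_weyl_chamber N"
  shows "1 / t ^ N * noncolliding_density N (1 / t) (\<lambda>j. x j / t) \<nu> = limit_density N t x \<nu>"
proof (cases "\<nu> \<in> weyl_chamber N")
  case True
  then show ?thesis
    using noncolliding_density_chamber[OF t x True]
    by (simp add: noncolliding_density_def continuous_extension_def)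
next
  case False
  let ?f = "\<lambda>z. vandermonde N (\<lambda>j. x j / t) / vandermonde N z * karlin_mcgregor N (1 / t) (\<lambda>j. x j / t) z"
  have f: "?f z = t ^ N * limit_density N t x z" if "z \<in> weyl_chamber N" for z
    unfolding noncolliding_density_chamber[OF t x that, symmetric] using t by simp
  have "(?f \<longlongrightarrow> t ^ N * limit_density N t x \<nu>) (at \<nu> within weyl_chamber N)"
    unfolding tendsto_at_iff_sequentially
  proof (intro allI impI)
    fix X assume X: "\<forall>i. X i \<in> weyl_chamber N - {\<nu>}" "X \<longlonglongrightarrow> \<nu>"
    have "(\<lambda>n. t ^ N * limit_density N t x (X n)) \<longlonglongrightarrow> t ^ N * limit_density N t x \<nu>"
      by (intro tendsto_mult tendsto_const limit_density_tendsto tendsto_coordinate X)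
    moreover have "(?f \<circ> X) = (\<lambda>n. t ^ N * limit_density N t x (X n))"
      using X(1) f by (auto simp: fun_eq_iff)
    ultimately show "(?f \<circ> X) \<longlonglongrightarrow> t ^ N * limit_density N t x \<nu>" by simp
  qed
  \<comment> \<open>Only along a nontrivial filter is \<open>Lim\<close> determined by
    convergence.\<close>
  moreover have "\<not> trivial_limit (at \<nu> within weyl_chamber N)"
  proof -
    have "\<forall>n. (\<lambda>j. \<nu> j + inverse (real (Suc n)) * real j) \<in> weyl_chamber N - {\<nu>}"
    proof
      fix n
      have "(\<lambda>j. \<nu> j + inverse (real (Suc n)) * real j) \<in> weyl_chamber N"
        by (rule weyl_chamber_perturb[OF \<nu>]) simp
      then show "(\<lambda>j. \<nu> j + inverse (real (Suc n)) * real j) \<in> weyl_chamber N - {\<nu>}"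
        using False by (auto simp only: Diff_iff singleton_iff)
    qed
    then show ?thesis
      unfolding trivial_limit_within islimpt_sequential not_not using perturb_tendsto[of \<nu>]
      by (intro exI[of _ "\<lambda>n j. \<nu> j + inverse (real (Suc n)) * real j"] conjI)
  qed
  ultimately have "Lim (at \<nu> within weyl_chamber N) ?f = t ^ N * limit_density N t x \<nu>"
    by (intro tendsto_Lim)
  then show ?thesis
    using False t by (simp add: noncolliding_density_def continuous_extension_def)
qed

text \<open>The determinant formula is used three times: with parameters \<open>\<mu>\<close> at
  \<open>x\<close> and at \<open>z\<close>, and with \<open>x / t\<close> as parameters at
  \<open>z\<close> for the Karlin-McGregor determinant. Dividing the two integrals at
  \<open>z\<close> by the volume at \<open>z\<close> isolates ratios that have limits as
  \<open>z\<close> tends to \<open>0\<close>.\<close>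

lemma noncolliding_drift_density_chamber:
  assumes t: "t > 0" and x: "mono_on {1..N} x" and \<mu>: "\<mu> \<in> weyl_chamber N" and z: "z \<in> weyl_chamber N"
  shows "exp (- t * norm_sq N \<mu> / 2) * (det_mat N (\<lambda>j k. exp (\<mu> j * x k)) / det_mat N (\<lambda>j k. exp (\<mu> j * z k))) *
      karlin_mcgregor N t x z =
    limit_density N t x \<mu> * exp (- norm_sq N z / (2 * t)) *
      (gt_real N (\<lambda>j. x j / t) z / gt_real N (\<lambda>_. 0) z) / (gt_real N \<mu> z / gt_real N (\<lambda>_. 0) z)"
proof -
  have zm: "mono_on {1..N} z"
    using z by (simp add: weyl_chamber_def strict_mono_on_imp_mono_on)
  have \<mu>0: "vdm N \<mu> \<noteq> 0"
    using vdm_pos[of N \<mu>] \<mu> by (simp add: weyl_chamber_def)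
  have z0: "gt_real N (\<lambda>_. 0) z \<noteq> 0"
    using gt_volume_pos[of N z] z by (simp add: weyl_chamber_def)
  have V: "vdm N (\<lambda>j. x j / t) = vdm N x / t ^ card (index_pairs N)"
    using vdm_scale[of N "1 / t" x] by (simp add: power_divide)
  show ?thesis
    unfolding karlin_mcgregor_eq[OF t] det_mat_eq_idet vdm_gt_real[OF x, symmetric] vdm_gt_real[OF zm, symmetric]
      limit_density_def V
    using \<mu>0 z0 by (simp add: mult_ac)
qed

lemma noncolliding_drift_density_eq:
  assumes N: "N \<ge> 2" and t: "t > 0" and x: "mono_on {1..N} x" and \<nu>: "\<nu> \<in> closed_weyl_chamber N"
  shows "noncolliding_drift_density N \<nu> t x (\<lambda>_. 0) = limit_density N t x \<nu>"
proof -
  let ?S = "weyl_chamber N \<times> weyl_chamber N" and ?p = "(\<nu>, \<lambda>_::nat. 0::real)"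
  let ?f = "\<lambda>(\<mu>, z). exp (- t * norm_sq N \<mu> / 2)
          * (det_mat N (\<lambda>j k. exp (\<mu> j * x k)) / det_mat N (\<lambda>j k. exp (\<mu> j * z k)))
          * karlin_mcgregor N t x z"
  \<comment> \<open>As \<open>N \<ge> 2\<close>, two coordinates of the origin coincide. The pair is
    thus outside the product of the chambers, whether or not \<open>\<nu>\<close> is interior, and
    the extension takes the value given by \<open>Lim\<close>.\<close>
  have "(\<lambda>_. 0) \<notin> weyl_chamber N"
    using N strict_mono_onD[of "{1..N}" "\<lambda>_. 0 :: real" 1 2] by (auto simp: weyl_chamber_def)
  then have p: "?p \<notin> ?S" by simp
  have "(?f \<longlongrightarrow> limit_density N t x \<nu>) (at ?p within ?S)"
    unfolding tendsto_at_iff_sequentially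
  proof (intro allI impI)
    fix X assume X: "\<forall>i. X i \<in> ?S - {?p}" "X \<longlonglongrightarrow> ?p"
    define \<mu> where "\<mu> n = fst (X n)" for n
    define z where "z n = snd (X n)" for n
    have W: "\<mu> n \<in> weyl_chamber N" "z n \<in> weyl_chamber N" for n
      using X(1) by (auto simp: \<mu>_def z_def mem_Times_iff)
    have lim: "(\<lambda>n. \<mu> n j) \<longlonglongrightarrow> \<nu> j" "(\<lambda>n. z n j) \<longlonglongrightarrow> 0" for j
      using tendsto_coordinate[OF tendsto_fst[OF X(2)], of j] tendsto_coordinate[OF tendsto_snd[OF X(2)], of j]
      by (simp_all add: \<mu>_def z_def)
    have sz: "strict_mono_on {1..N} (z n)" for n using W(2) by (simp add: weyl_chamber_def)
    have "(\<lambda>n. exp (- norm_sq N (z n) / (2 * t))) \<longlonglongrightarrow> exp (- (\<Sum>j=1..N. 0\<^sup>2) / (2 * t))"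
      unfolding norm_sq_def using t
      by (intro tendsto_exp tendsto_divide tendsto_minus tendsto_const tendsto_sum tendsto_power lim) auto
    then have e: "(\<lambda>n. exp (- norm_sq N (z n) / (2 * t))) \<longlonglongrightarrow> 1" by simp
    have "(\<lambda>n. limit_density N t x (\<mu> n) * exp (- norm_sq N (z n) / (2 * t)) *
      (gt_real N (\<lambda>j. x j / t) (z n) / gt_real N (\<lambda>_. 0) (z n)) / (gt_real N (\<mu> n) (z n) / gt_real N (\<lambda>_. 0) (z n)))
      \<longlonglongrightarrow> limit_density N t x \<nu> * 1 * 1 / 1"
      by (rule tendsto_divide[OF tendsto_mult[OF tendsto_mult[OF limit_density_tendsto[OF lim(1)] e]
            gt_real_ratio_tendsto[OF sz lim(2) tendsto_const]] gt_real_ratio_tendsto[OF sz lim(2) lim(1)]]) simp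
    moreover have "(?f \<circ> X) = (\<lambda>n. limit_density N t x (\<mu> n) * exp (- norm_sq N (z n) / (2 * t)) *
      (gt_real N (\<lambda>j. x j / t) (z n) / gt_real N (\<lambda>_. 0) (z n)) / (gt_real N (\<mu> n) (z n) / gt_real N (\<lambda>_. 0) (z n)))"
      using noncolliding_drift_density_chamber[OF t x W]
      by (simp add: fun_eq_iff case_prod_beta \<mu>_def z_def)
    ultimately show "(?f \<circ> X) \<longlonglongrightarrow> limit_density N t x \<nu>" by simp
  qed
  moreover have "\<not> trivial_limit (at ?p within ?S)"
  proof -
    let ?X = "\<lambda>n. (\<lambda>j. \<nu> j + inverse (real (Suc n)) * real j, \<lambda>j. 0 + inverse (real (Suc n)) * real j)"
    have "(\<lambda>_. 0) \<in> closed_weyl_chamber N" by (simp add: closed_weyl_chamber_def mono_on_def)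
    then have X: "?X n \<in> ?S" for n
      using \<nu> by (intro SigmaI weyl_chamber_perturb) auto
    have "\<forall>n. ?X n \<in> ?S - {?p}"
    proof
      fix n
      have "?X n \<noteq> ?p"
      proof
        assume "?X n = ?p"
        with X[of n] have "?p \<in> ?S" by (rule subst[rotated])
        with p show False by contradiction
      qed
      with X[of n] show "?X n \<in> ?S - {?p}" by (simp only: Diff_iff singleton_iff not_False_eq_True)
    qed
    moreover have "?X \<longlonglongrightarrow> ?p" by (intro tendsto_Pair perturb_tendsto)
    ultimately show ?thesis
      unfolding trivial_limit_within islimpt_sequential not_not by (intro exI[of _ ?X] conjI)
  qed
  ultimately have "Lim (at ?p within ?S) ?f = limit_density N t x \<nu>"
    by (intro tendsto_Lim)
  then show ?thesis
    unfolding noncolliding_drift_density_def continuous_extension_def using p by (simp only: if_False)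
qed

theorem lemma2p1:
  fixes N :: nat and \<nu> x :: "nat \<Rightarrow> real" and t :: real
  assumes "N \<ge> 2"
    and "\<nu> \<in> closed_weyl_chamber N"
    and "t > 0"
    and "x \<in> weyl_chamber N"
  shows "((\<lambda>a. oconnell_density N (\<lambda>j. a * \<nu> j) a t x) \<longlongrightarrow>
            complex_of_real (1 / t ^ N * noncolliding_density N (1 / t) (\<lambda>j. x j / t) \<nu>))
           (at_right (0::real))
       \<and> 1 / t ^ N * noncolliding_density N (1 / t) (\<lambda>j. x j / t) \<nu>
           = noncolliding_drift_density N \<nu> t x (\<lambda>_. 0)"
proof -
  have x: "mono_on {1..N} x"
    using assms(4) by (simp add: weyl_chamber_def strict_mono_on_imp_mono_on)
  show ?thesis
    unfolding noncolliding_density_eq[OF assms(3) x assms(2)] noncolliding_drift_density_eq[OF assms(1,3) x assms(2)]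
    using oconnell_density_tendsto[OF assms(3) x] by simp
qed

end
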